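(* Let $G$ be a group that obeys a law, i.e. there exist a free group $F$ and a nontrivial element $w \in F$ such that $\rho(w) = \mathrm{id}$ for every homomorphism $\rho : F \to G$. Then $\mathrm{scl}(g) = 0$ for every $g$ in the commutator subgroup $[G,G]$, where $\mathrm{scl}$ denotes stable commutator length in $G$.
   Context: Let $G$ be a group and let $[G,G]$ be its commutator subgroup. For $g \in [G,G]$, the commutator length $\mathrm{cl}(g)$ is the least number of commutators in $G$ whose product is $g$. The stable commutator length of $g \in [G,G]$ is the limit $\mathrm{scl}(g) := \lim_{n \to \infty} \mathrm{cl}(g^n)/n$. A group $G$ is said to obey a law if there is a free group $F$ (which may be assumed to have finite rank) and a nontrivial element $w \in F$ such that for every homomorphism $\rho : F \to G$ we have $\rho(w) = \mathrm{id}$. *)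

theory Defs
  imports Complex_Main "HOL-Algebra.Generated_Groups"
begin

section \<open>Free groups\<close>

text \<open>A letter \<open>(x, True)\<close> stands for the generator \<open>x\<close>, and \<open>(x, False)\<close> for its inverse.\<close>

type_synonym 'x letter = "'x \<times> bool"

definition inv_letter :: "'x letter \<Rightarrow> 'x letter" where
  "inv_letter a = (fst a, \<not> snd a)"

definition reduced :: "'x letter list \<Rightarrow> bool" where
  "reduced w \<longleftrightarrow> successively (\<lambda>a b. b \<noteq> inv_letter a) w"

text \<open>Left multiplication of a reduced word by a letter, followed by cancellation.\<close>

fun push :: "'x letter \<Rightarrow> 'x letter list \<Rightarrow> 'x letter list" where
  "push a [] = [a]"
| "push a (b # v) = (if b = inv_letter a then v else a # b # v)"

definition free_group :: "'x set \<Rightarrow> 'x letter list monoid" where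
  "free_group X =
    \<lparr>carrier = {w. reduced w \<and> fst ` set w \<subseteq> X}, mult = (\<lambda>u v. foldr push u v), one = []\<rparr>"

definition word_eval :: "('g, 'm) monoid_scheme \<Rightarrow> ('x \<Rightarrow> 'g) \<Rightarrow> 'x letter list \<Rightarrow> 'g" where
  "word_eval G f w =
    foldr (\<lambda>a y. (if snd a then f (fst a) else inv\<^bsub>G\<^esub> f (fst a)) \<otimes>\<^bsub>G\<^esub> y) w \<one>\<^bsub>G\<^esub>"

text \<open>\<open>S\<close> is a free basis of \<open>F\<close> if the canonical homomorphism from the group of reduced words
  over \<open>S\<close> to \<open>F\<close> is an isomorphism. The set \<open>S\<close> may be infinite.\<close>

definition free_basis :: "('f, 'm) monoid_scheme \<Rightarrow> 'f set \<Rightarrow> bool" where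
  "free_basis F S \<longleftrightarrow> S \<subseteq> carrier F \<and> word_eval F (\<lambda>x. x) \<in> iso (free_group S) F"

definition is_free_group :: "('f, 'm) monoid_scheme \<Rightarrow> bool" where
  "is_free_group F \<longleftrightarrow> group F \<and> (\<exists>S. free_basis F S)"

lemma inv_letter_simps [simp]:
  "inv_letter (inv_letter a) = a" "fst (inv_letter a) = fst a" "snd (inv_letter a) = (\<not> snd a)"
  "inv_letter a \<noteq> a" "a \<noteq> inv_letter a"
  by (auto simp: inv_letter_def prod_eq_iff)

lemma inv_letter_eq_iff: "b = inv_letter a \<longleftrightarrow> a = inv_letter b"
  by (metis inv_letter_simps(1))

lemma reduced_Nil [simp]: "reduced []"
  by (simp add: reduced_def)

lemma reduced_Cons: "reduced (a # w) \<longleftrightarrow> reduced w \<and> (w = [] \<or> hd w \<noteq> inv_letter a)"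
  by (auto simp: reduced_def successively_Cons)

lemma reduced_push: "reduced w \<Longrightarrow> reduced (push a w)"
  by (cases w) (auto simp: reduced_Cons)

lemma set_push: "set (push a w) \<subseteq> insert a (set w)"
  by (cases w) auto

lemma push_push_inv: "reduced w \<Longrightarrow> push (inv_letter a) (push a w) = w"
  by (cases w rule: list.exhaust; cases "tl w") (auto simp: reduced_Cons)

lemma push_reduced_Cons: "reduced (a # w) \<Longrightarrow> push a w = a # w"
  by (cases w) (auto simp: reduced_Cons)

lemma reduced_foldr_push: "reduced v \<Longrightarrow> reduced (foldr push u v)"
  by (induction u) (auto intro: reduced_push)

lemma set_foldr_push: "set (foldr push u v) \<subseteq> set u \<union> set v"
  by (induction u) (use set_push in fastforce)+

lemma foldr_push_push:
  assumes "reduced v"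
  shows "foldr push (push a u) v = push a (foldr push u v)"
proof (cases u)
  case (Cons b u')
  show ?thesis
  proof (cases "b = inv_letter a")
    case True
    then show ?thesis
      using Cons push_push_inv[of "foldr push u' v" "inv_letter a"] reduced_foldr_push[OF assms]
      by simp
  qed (use Cons in auto)
qed auto

lemma foldr_push_assoc:
  "reduced w \<Longrightarrow> foldr push (foldr push u v) w = foldr push u (foldr push v w)"
  by (induction u) (auto simp: foldr_push_push)

lemma foldr_push_Nil: "reduced u \<Longrightarrow> foldr push u [] = u"
  by (induction u) (auto simp: push_reduced_Cons, simp add: reduced_Cons push_reduced_Cons)

lemma foldr_push_inverse: "foldr push (rev (map inv_letter u)) (foldr push u []) = []"
proof (induction u)
  case (Cons a u)
  then show ?case
    using push_push_inv[of "foldr push u []" a] by (simp add: reduced_foldr_push)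
qed auto

lemma reduced_inverse: "reduced u \<Longrightarrow> reduced (rev (map inv_letter u))"
  unfolding reduced_def successively_rev successively_map
  by (erule successively_mono) (metis inv_letter_eq_iff)

lemma group_free_group: "group (free_group X)"
proof (rule groupI)
  fix u v assume "u \<in> carrier (free_group X)" "v \<in> carrier (free_group X)"
  then show "u \<otimes>\<^bsub>free_group X\<^esub> v \<in> carrier (free_group X)"
    using set_foldr_push[of u v] reduced_foldr_push[of v u] by (fastforce simp: free_group_def)
next
  fix u assume u: "u \<in> carrier (free_group X)"
  let ?v = "rev (map inv_letter u)"
  have "?v \<in> carrier (free_group X)"
    using u reduced_inverse[of u] by (auto simp: free_group_def)
  moreover have "?v \<otimes>\<^bsub>free_group X\<^esub> u = \<one>\<^bsub>free_group X\<^esub>"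
    using foldr_push_inverse[of u] foldr_push_Nil[of u] u by (simp add: free_group_def)
  ultimately show "\<exists>v\<in>carrier (free_group X). v \<otimes>\<^bsub>free_group X\<^esub> u = \<one>\<^bsub>free_group X\<^esub>" ..
qed (auto simp: free_group_def foldr_push_assoc)

context group
begin

lemma word_eval_closed:
  "f ` X \<subseteq> carrier G \<Longrightarrow> fst ` set w \<subseteq> X \<Longrightarrow> word_eval G f w \<in> carrier G"
  by (induction w) (auto simp: word_eval_def)

lemma word_eval_push:
  assumes "f ` X \<subseteq> carrier G" "fst a \<in> X" "fst ` set w \<subseteq> X"
  shows "word_eval G f (push a w) = word_eval G f (a # w)"
proof (cases w)
  case (Cons b v)
  have v: "word_eval G f v \<in> carrier G"
    using assms Cons by (intro word_eval_closed[of f X]) auto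
  have a: "f (fst a) \<in> carrier G"
    using assms by auto
  show ?thesis
    using v a Cons
    by (auto simp: word_eval_def m_assoc[symmetric])
qed auto

lemma word_eval_hom:
  assumes f: "f ` X \<subseteq> carrier G"
  shows "word_eval G f \<in> hom (free_group X) G"
proof (rule homI)
  fix u v assume uv: "u \<in> carrier (free_group X)" "v \<in> carrier (free_group X)"
  have v: "fst ` set v \<subseteq> X" and "fst ` set u \<subseteq> X"
    using uv by (auto simp: free_group_def)
  from this(2) have "word_eval G f (foldr push u v) = word_eval G f u \<otimes> word_eval G f v"
  proof (induction u)
    case Nil
    then show ?case using word_eval_closed[OF f v] by (simp add: word_eval_def)
  next
    case (Cons a u)
    have "fst ` set (foldr push u v) \<subseteq> X"
      using set_foldr_push[of u v] v Cons.prems by fastforce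
    then have "word_eval G f (foldr push (a # u) v) = word_eval G f (a # foldr push u v)"
      using word_eval_push[OF f, of a] Cons.prems by simp
    also have "\<dots> = (if snd a then f (fst a) else inv f (fst a)) \<otimes> (word_eval G f u \<otimes> word_eval G f v)"
      using Cons by (simp add: word_eval_def)
    also have "\<dots> = word_eval G f (a # u) \<otimes> word_eval G f v"
      using f Cons.prems word_eval_closed[OF f v] word_eval_closed[OF f, of u]
      by (auto simp: word_eval_def m_assoc image_subset_iff)
    finally show ?case .
  qed
  then show "word_eval G f (u \<otimes>\<^bsub>free_group X\<^esub> v) = word_eval G f u \<otimes> word_eval G f v"
    by (simp add: free_group_def)
next
  fix w assume "w \<in> carrier (free_group X)"
  then show "word_eval G f w \<in> carrier G"
    by (intro word_eval_closed[OF f]) (simp add: free_group_def)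
qed

lemma hom_word_eval:
  assumes H: "group H" and h: "h \<in> hom G H" and f: "f ` X \<subseteq> carrier G" and w: "fst ` set w \<subseteq> X"
  shows "h (word_eval G f w) = word_eval H (h \<circ> f) w"
  using w
proof (induction w)
  case Nil
  then show ?case using h H is_group by (simp add: word_eval_def hom_one)
next
  case (Cons a w)
  interpret h: group_hom G H h
    using h H is_group by (simp add: group_hom_def group_hom_axioms_def)
  have "f (fst a) \<in> carrier G" "word_eval G f w \<in> carrier G"
    using f Cons.prems word_eval_closed[OF f, of w] by auto
  then show ?case
    using Cons by (auto simp: word_eval_def)
qed

end

text \<open>The universal property of free groups.\<close>

lemma free_basis_extension:
  assumes F: "group F" and S: "free_basis F S" and H: "group H" and f: "f ` S \<subseteq> carrier H"
  shows "\<exists>h \<in> hom F H. \<forall>x\<in>S. h x = f x"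
proof -
  have iso: "word_eval F (\<lambda>x. x) \<in> iso (free_group S) F" and SF: "S \<subseteq> carrier F"
    using S by (auto simp: free_basis_def)
  let ?\<psi> = "inv_into (carrier (free_group S)) (word_eval F (\<lambda>x. x))"
  have \<psi>: "?\<psi> \<in> hom F (free_group S)"
    using group.iso_set_sym[OF group_free_group iso] by (simp add: iso_def)
  have "?\<psi> x = [(x, True)]" if "x \<in> S" for x
  proof (rule inv_into_f_eq)
    show "inj_on (word_eval F (\<lambda>x. x)) (carrier (free_group S))"
      using iso by (simp add: iso_def bij_betw_def)
    show "[(x, True)] \<in> carrier (free_group S)"
      using that by (simp add: free_group_def reduced_Cons)
    show "word_eval F (\<lambda>x. x) [(x, True)] = x"
      using that SF group.is_monoid[OF F] by (auto simp: word_eval_def monoid.r_one)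
  qed
  then have "\<forall>x\<in>S. (word_eval H f \<circ> ?\<psi>) x = f x"
    using f group.is_monoid[OF H] by (auto simp: word_eval_def monoid.r_one image_subset_iff)
  moreover have "word_eval H f \<circ> ?\<psi> \<in> hom F H"
    using hom_compose[OF \<psi> group.word_eval_hom[OF H f]] .
  ultimately show ?thesis by blast
qed

lemma free_basis_extension_unique:
  assumes F: "group F" and S: "free_basis F S" and H: "group H"
    and h: "h \<in> hom F H" "h' \<in> hom F H" and eq: "\<forall>x\<in>S. h x = h' x" and y: "y \<in> carrier F"
  shows "h y = h' y"
proof -
  have SF: "S \<subseteq> carrier F" and "word_eval F (\<lambda>x. x) ` carrier (free_group S) = carrier F"
    using S by (auto simp: free_basis_def iso_def bij_betw_def)
  then obtain w where w: "fst ` set w \<subseteq> S" "y = word_eval F (\<lambda>x. x) w"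
    using y by (force simp: free_group_def)
  have "word_eval H (h \<circ> (\<lambda>x. x)) w = word_eval H (h' \<circ> (\<lambda>x. x)) w"
    using w(1) eq by (induction w) (auto simp: word_eval_def)
  then show ?thesis
    using group.hom_word_eval[OF F H h(1), of "\<lambda>x. x" S w]
      group.hom_word_eval[OF F H h(2), of "\<lambda>x. x" S w] SF w by simp
qed

lemma is_free_group_free_group: "is_free_group (free_group X)"
proof -
  let ?F = "free_group X" and ?i = "\<lambda>x. [(x, True)]"
  let ?S = "?i ` X"
  let ?r = "map (\<lambda>a. (?i (fst a), snd a))" and ?e = "word_eval ?F (\<lambda>x. x)"
  have S: "?S \<subseteq> carrier ?F"
    by (auto simp: free_group_def reduced_Cons)
  interpret F: group ?F by (rule group_free_group)
  have hom: "?e \<in> hom (free_group ?S) ?F"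
    using F.word_eval_hom[of "\<lambda>x. x" ?S] S by simp
  have inv: "inv\<^bsub>?F\<^esub> ?i x = [(x, False)]" if "x \<in> X" for x
    by (rule F.inv_equality) (use that in \<open>auto simp: free_group_def reduced_Cons inv_letter_def\<close>)
  have e_r: "?e (?r w) = w" if "w \<in> carrier ?F" for w
  proof -
    have "fst ` set w \<subseteq> X" "reduced w" using that by (auto simp: free_group_def)
    then show ?thesis
    proof (induction w)
      case Nil
      then show ?case by (simp add: word_eval_def free_group_def)
    next
      case (Cons a w)
      have "?e (?r (a # w)) = (if snd a then ?i (fst a) else [(fst a, False)]) \<otimes>\<^bsub>?F\<^esub> ?e (?r w)"
        using Cons.prems inv[of "fst a"] by (auto simp: word_eval_def)
      also have "?e (?r w) = w" using Cons by (simp add: reduced_Cons)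
      also have "(if snd a then ?i (fst a) else [(fst a, False)]) = [a]"
        by (cases a) auto
      also have "[a] \<otimes>\<^bsub>?F\<^esub> w = a # w"
        using Cons.prems(2) by (simp add: free_group_def push_reduced_Cons)
      finally show ?case .
    qed
  qed
  have red: "reduced (?r w) = reduced w" for w :: "'a letter list"
    unfolding reduced_def successively_map by (simp add: inv_letter_def prod_eq_iff)
  have "?r ` carrier ?F = carrier (free_group ?S)"
  proof (intro equalityI subsetI)
    fix v assume v: "v \<in> carrier (free_group ?S)"
    let ?w = "map (\<lambda>a. (fst (hd (fst a)), snd a)) v"
    have "?r ?w = v"
      using v by (auto simp: free_group_def intro!: map_idI)
    moreover from this have "?w \<in> carrier ?F"
      using v red[of ?w] by (force simp: free_group_def)
    ultimately show "v \<in> ?r ` carrier ?F" by (intro rev_image_eqI) (assumption, rule sym)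
  next
    fix v assume "v \<in> ?r ` carrier ?F"
    then obtain w where w: "w \<in> carrier ?F" "v = ?r w" by blast
    have "reduced v" using w red[of w] by (simp only: free_group_def) simp
    moreover have "fst ` set v \<subseteq> ?S" using w by (auto simp: free_group_def)
    ultimately show "v \<in> carrier (free_group ?S)" by (simp only: free_group_def) simp
  qed
  note img = this
  have "inj_on ?e (carrier (free_group ?S))"
  proof (rule inj_onI)
    fix u v assume uv: "u \<in> carrier (free_group ?S)" "v \<in> carrier (free_group ?S)" "?e u = ?e v"
    then obtain u' v' where "u' \<in> carrier ?F" "v' \<in> carrier ?F" "u = ?r u'" "v = ?r v'"
      unfolding img[symmetric] by blast
    then show "u = v" using uv(3) e_r[of u'] e_r[of v'] by (simp only:)
  qed
  moreover have "?e ` carrier (free_group ?S) = carrier ?F"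
    unfolding img[symmetric] image_image using e_r by (intro equalityI subsetI) (auto simp: image_iff)
  ultimately have "bij_betw ?e (carrier (free_group ?S)) (carrier ?F)"
    by (simp add: bij_betw_def)
  with hom S have "free_basis ?F ?S"
    unfolding free_basis_def iso_def by (intro conjI CollectI)
  then show ?thesis
    unfolding is_free_group_def using F.is_group by (intro conjI exI)
qed


section \<open>Commutator length and stable commutator length\<close>

text \<open>Both are meant for \<open>g\<close> in the commutator subgroup \<open>derived G (carrier G)\<close>. Here
  \<open>derived_set G (carrier G)\<close> is the set of all commutators \<open>a b a\<^sup>-\<^sup>1 b\<^sup>-\<^sup>1\<close>; the empty product
  gives the identity commutator length 0.\<close>

definition comm_length :: "('g, 'm) monoid_scheme \<Rightarrow> 'g \<Rightarrow> nat" where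
  "comm_length G g =
    (LEAST n. \<exists>cs. length cs = n \<and> set cs \<subseteq> derived_set G (carrier G) \<and>
                   foldr (\<otimes>\<^bsub>G\<^esub>) cs \<one>\<^bsub>G\<^esub> = g)"

definition scl :: "('g, 'm) monoid_scheme \<Rightarrow> 'g \<Rightarrow> real" where
  "scl G g = lim (\<lambda>n. real (comm_length G (g [^]\<^bsub>G\<^esub> n)) / real n)"

text \<open>The rest of this section shows that the least number and the limit exist.\<close>

context group
begin

lemma foldr_mult_closed:
  "set cs \<subseteq> carrier G \<Longrightarrow> foldr (\<otimes>) cs \<one> \<in> carrier G"
  by (induction cs) auto

lemma foldr_mult_append:
  "set cs \<subseteq> carrier G \<Longrightarrow> set ds \<subseteq> carrier G \<Longrightarrow>
    foldr (\<otimes>) (cs @ ds) \<one> = foldr (\<otimes>) cs \<one> \<otimes> foldr (\<otimes>) ds \<one>"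
proof (induction cs)
  case Nil
  then show ?case using foldr_mult_closed[of ds] by simp
next
  case (Cons c cs)
  then show ?case
    using foldr_mult_closed[of cs] foldr_mult_closed[of ds]
    by (simp add: m_assoc)
qed

lemma derived_prod_commutators:
  assumes "g \<in> derived G (carrier G)"
  shows "\<exists>cs. set cs \<subseteq> derived_set G (carrier G) \<and> foldr (\<otimes>) cs \<one> = g"
proof -
  have DC: "derived_set G (carrier G) \<subseteq> carrier G"
    by (rule derived_set_in_carrier) simp
  have "g \<in> generate G (derived_set G (carrier G))"
    using assms by (simp only: derived_def)
  then show ?thesis
  proof (induction rule: generate.induct)
    case one
    show ?case by (intro exI[of _ "[]"]) simp
  next
    case (incl h)
    then have "h \<in> carrier G" using DC by (rule subsetD[rotated])
    then show ?case using incl by (intro exI[of _ "[h]"]) (simp del: UN_iff)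
  next
    case (inv h)
    then obtain a b where ab: "a \<in> carrier G" "b \<in> carrier G" "h = a \<otimes> b \<otimes> inv a \<otimes> inv b"
      by blast
    then have "inv h = b \<otimes> a \<otimes> inv b \<otimes> inv a"
      by (simp add: inv_mult_group m_assoc)
    then have "inv h \<in> derived_set G (carrier G)" using ab by blast
    moreover from this have "inv h \<in> carrier G" using DC by (rule subsetD[rotated])
    ultimately show ?case by (intro exI[of _ "[inv h]"]) (simp del: UN_iff)
  next
    case (eng h1 h2)
    then obtain cs ds where
      "set cs \<subseteq> derived_set G (carrier G)" "foldr (\<otimes>) cs \<one> = h1"
      "set ds \<subseteq> derived_set G (carrier G)" "foldr (\<otimes>) ds \<one> = h2"
      by blast
    moreover from this have "set cs \<subseteq> carrier G" "set ds \<subseteq> carrier G"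
      using DC by (auto simp del: UN_iff)
    ultimately show ?case
      using foldr_mult_append[of cs ds]
      by (intro exI[of _ "cs @ ds"] conjI) (simp_all only: set_append Un_least)
  qed
qed

lemma comm_length_witness:
  assumes "g \<in> derived G (carrier G)"
  shows "\<exists>cs. length cs = comm_length G g \<and> set cs \<subseteq> derived_set G (carrier G) \<and>
              foldr (\<otimes>) cs \<one> = g"
  unfolding comm_length_def
  by (rule LeastI_ex) (use derived_prod_commutators[OF assms] in blast)

lemma comm_length_le:
  "set cs \<subseteq> derived_set G (carrier G) \<Longrightarrow> foldr (\<otimes>) cs \<one> = g \<Longrightarrow> comm_length G g \<le> length cs"
  unfolding comm_length_def by (rule Least_le) blast

lemma comm_length_mult:
  assumes "g \<in> derived G (carrier G)" "h \<in> derived G (carrier G)"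
  shows "comm_length G (g \<otimes> h) \<le> comm_length G g + comm_length G h"
proof -
  have DC: "derived_set G (carrier G) \<subseteq> carrier G"
    by (rule derived_set_in_carrier) simp
  obtain cs where cs: "length cs = comm_length G g" "set cs \<subseteq> derived_set G (carrier G)"
      "foldr (\<otimes>) cs \<one> = g"
    using comm_length_witness[OF assms(1)] by blast
  obtain ds where ds: "length ds = comm_length G h" "set ds \<subseteq> derived_set G (carrier G)"
      "foldr (\<otimes>) ds \<one> = h"
    using comm_length_witness[OF assms(2)] by blast
  have "foldr (\<otimes>) (cs @ ds) \<one> = g \<otimes> h"
    using foldr_mult_append[of cs ds] cs ds DC by (simp only: subset_trans)
  then have "comm_length G (g \<otimes> h) \<le> length (cs @ ds)"
    by (intro comm_length_le) (use cs(2) ds(2) in \<open>simp_all only: set_append Un_least\<close>)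
  then show ?thesis using cs(1) ds(1) by simp
qed

end

lemma subadditive_convergent:
  fixes a :: "nat \<Rightarrow> nat"
  assumes sub: "\<And>m n. a (m + n) \<le> a m + a n"
  shows "convergent (\<lambda>n. real (a n) / real n)"
proof -
  define L where "L = (INF n\<in>{1..}. real (a n) / real n)"
  have bdd: "bdd_below ((\<lambda>n. real (a n) / real n) ` {1..})"
    by (rule bdd_belowI[of _ 0]) auto
  have L: "L \<le> real (a n) / real n" if "n \<ge> 1" for n
    unfolding L_def by (rule cINF_lower[OF bdd]) (use that in auto)
  have "(\<lambda>n. real (a n) / real n) \<longlonglongrightarrow> L"
  proof (rule LIMSEQ_I)
    fix e :: real assume e: "e > 0"
    have "\<exists>N\<in>{1..}. real (a N) / real N < L + e / 2"
    proof -
      have "{Suc 0..} \<noteq> {}" "(INF n\<in>{1..}. real (a n) / real n) < L + e / 2"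
        using e unfolding L_def[symmetric] by auto
      then show ?thesis
        using cINF_less_iff[OF _ bdd, of "L + e / 2"] by simp
    qed
    then obtain N where N: "N \<ge> 1" "real (a N) / real N < L + e / 2" by auto
    have mult: "a (q * N + r) \<le> q * a N + a r" for q r
    proof (induction q)
      case (Suc q)
      have "a (Suc q * N + r) \<le> a N + a (q * N + r)"
        using sub[of N "q * N + r"] by (simp add: add.assoc)
      then show ?case using Suc by simp
    qed auto
    define M where "M = Max (a ` {..<N})"
    have M: "a r \<le> M" if "r < N" for r
      unfolding M_def by (rule Max_ge) (use that in auto)
    have bound: "real (a n) \<le> real n * (real (a N) / real N) + real M" for n
    proof -
      have "a n \<le> (n div N) * a N + M"
        using mult[of "n div N" "n mod N"] M[of "n mod N"] N(1) by simp
      then have "real (a n) \<le> real (n div N) * real (a N) + real M"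
        by (metis of_nat_add of_nat_le_iff of_nat_mult)
      moreover have "real (n div N) * real (a N) \<le> real n / real N * real (a N)"
        by (intro mult_right_mono of_nat_div_le_of_nat) auto
      ultimately show ?thesis by simp
    qed
    obtain K :: nat where K: "real M / (e / 2) < real K"
      using reals_Archimedean2 by blast
    show "\<exists>no. \<forall>n\<ge>no. norm (real (a n) / real n - L) < e"
    proof (intro exI allI impI)
      fix n assume n: "n \<ge> Suc K"
      then have n0: "real n > 0" by simp
      have "real M < real K * (e / 2)"
        using K e by (simp only: pos_divide_less_eq half_gt_zero)
      also have "\<dots> \<le> real n * (e / 2)"
        using n e by (intro mult_right_mono) auto
      finally have "real M / real n < e / 2"
        using n0 by (simp add: pos_divide_less_eq mult.commute)
      moreover have "real (a n) / real n \<le> real (a N) / real N + real M / real n"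
        using bound[of n] n0 by (simp add: field_simps)
      moreover have "L \<le> real (a n) / real n" using L n by simp
      ultimately show "norm (real (a n) / real n - L) < e"
        unfolding real_norm_def using N(2) by linarith
    qed
  qed
  then show ?thesis by (auto simp: convergent_def)
qed

lemma (in group) scl_limit:
  assumes "g \<in> derived G (carrier G)"
  shows "(\<lambda>n. real (comm_length G (g [^] n)) / real n) \<longlonglongrightarrow> scl G g"
proof -
  have sub: "subgroup (derived G (carrier G)) G"
    by (rule derived_is_subgroup) simp
  have g: "g \<in> carrier G"
    using subgroup.mem_carrier[OF sub assms] .
  have pow: "g [^] (n::nat) \<in> derived G (carrier G)" for n
    by (induction n) (use sub assms in \<open>auto intro: subgroup.one_closed subgroup.m_closed\<close>)
  have "convergent (\<lambda>n. real (comm_length G (g [^] n)) / real n)"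
    by (rule subadditive_convergent)
      (use comm_length_mult[OF pow pow] g in \<open>simp add: nat_pow_mult\<close>)
  then show ?thesis
    unfolding scl_def by (simp add: convergent_LIMSEQ_iff)
qed

end

theory Submission
  imports Defs "HOL-Library.Multiset"
begin

text \<open>It suffices that, for some \<open>n\<close> and some \<open>m < n/2\<close>, every \<open>[a, b]\<^sup>n\<close> is a product of \<open>m\<close>
  commutators. Indeed \<open>(x y)\<^sup>n\<close> equals \<open>x\<^sup>n y\<^sup>n\<close> up to \<open>n/2\<close> commutators, so the \<open>n\<close>-th power of a
  product of \<open>k\<close> commutators is then a product of \<open>k (m + n/2)\<close> of them, and iterating this gives
  \<open>scl = 0\<close>. (Over a free group \<open>scl [a, b] = 1/2\<close>, so a law has to improve on this only slightly.)

  The improvement comes from a cyclically reduced law \<open>v\<close> in \<open>a, b\<close>, drawn as a loop on the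
  once-punctured torus with boundary \<open>c = [a, b]\<close>. Pushed to one side, it becomes a product of
  positive powers of \<open>c\<close> with factors \<open>\<alpha>\<close>, \<open>\<beta>\<close>, \<open>c \<alpha>\<^sup>-\<^sup>1\<close>, \<open>c \<beta>\<^sup>-\<^sup>1\<close> where \<open>\<alpha> = a\<close>,
  \<open>\<beta> = a b a\<^sup>-\<^sup>1\<close>, and after possibly replacing \<open>v\<close> by its inverse there are at least half as many \<open>c\<close>
  as \<open>\<alpha>\<^sup>\<plusminus>, \<beta>\<^sup>\<plusminus>\<close>. If \<open>v\<close> has exponent sums 0, the latter cancel in pairs. In \<open>N\<close>-th powers each
  cancellation costs \<open>N/2\<close> commutators, except that the first is free because \<open>v = 1\<close>. With \<open>K\<close>
  letters \<open>c\<close> this leaves \<open>c\<^sup>K\<^sup>N\<close> as a product of at most \<open>(K - 1) N/2 + O(1)\<close> commutators, uniformly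
  in \<open>a, b\<close>. If an exponent sum of \<open>v\<close> is nonzero, \<open>G\<close> has finite exponent and all is clear.\<close>

section \<open>Products of commutators\<close>

context group
begin

lemma inv_cancel_left [simp]:
  assumes "x \<in> carrier G" "y \<in> carrier G"
  shows "inv x \<otimes> (x \<otimes> y) = y" "x \<otimes> (inv x \<otimes> y) = y"
  using assms by (simp_all add: m_assoc[symmetric])

lemma conj_pow:
  fixes n :: nat
  assumes "x \<in> carrier G" "g \<in> carrier G"
  shows "(g \<otimes> x \<otimes> inv g) [^] n = g \<otimes> x [^] n \<otimes> inv g"
  by (induction n) (use assms in \<open>simp_all add: m_assoc\<close>)

text \<open>Exactly \<open>n\<close> factors already encodes "at most \<open>n\<close>": \<one> is a
  commutator, so products can be padded (\<open>commutator_products_mono\<close>).\<close>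

definition commutator_products :: "nat \<Rightarrow> 'a set" where
  "commutator_products n =
    {g. \<exists>cs. length cs = n \<and> set cs \<subseteq> derived_set G (carrier G) \<and> foldr (\<otimes>) cs \<one> = g}"

lemma derived_set_closed: "derived_set G (carrier G) \<subseteq> carrier G"
  by (rule derived_set_in_carrier) simp

lemma commutator_in_derived_set:
  "a \<in> carrier G \<Longrightarrow> b \<in> carrier G \<Longrightarrow> a \<otimes> b \<otimes> inv a \<otimes> inv b \<in> derived_set G (carrier G)"
  by blast

lemma one_in_derived_set: "\<one> \<in> derived_set G (carrier G)"
  using commutator_in_derived_set[of \<one> \<one>] by simp

lemma commutator_products_closed: "g \<in> commutator_products n \<Longrightarrow> g \<in> carrier G"
  unfolding commutator_products_def using derived_set_closed foldr_mult_closed by blast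

lemma commutator_products_0 [simp]: "commutator_products 0 = {\<one>}"
  by (auto simp: commutator_products_def)

lemma commutator_products_SucI:
  assumes "c \<in> derived_set G (carrier G)" "g \<in> commutator_products n"
  shows "c \<otimes> g \<in> commutator_products (Suc n)"
proof -
  obtain cs where "length cs = n" "set cs \<subseteq> derived_set G (carrier G)" "foldr (\<otimes>) cs \<one> = g"
    using assms(2) unfolding commutator_products_def by blast
  then show ?thesis
    unfolding commutator_products_def
    by (intro CollectI exI[of _ "c # cs"]) (use assms(1) in \<open>simp del: UN_iff\<close>)
qed

lemma commutator_products_SucE:
  assumes "g \<in> commutator_products (Suc n)"
  obtains c h where "c \<in> derived_set G (carrier G)" "h \<in> commutator_products n" "g = c \<otimes> h"
proof -
  obtain cs where cs: "length cs = Suc n" "set cs \<subseteq> derived_set G (carrier G)" "foldr (\<otimes>) cs \<one> = g"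
    using assms unfolding commutator_products_def by blast
  obtain c ds where "cs = c # ds" using cs(1) by (cases cs) auto
  with cs show thesis
    by (intro that[of c "foldr (\<otimes>) ds \<one>"]) (auto simp: commutator_products_def simp del: UN_iff)
qed

lemma commutator_products_1:
  assumes "a \<in> carrier G" "b \<in> carrier G"
  shows "a \<otimes> b \<otimes> inv a \<otimes> inv b \<in> commutator_products 1"
  using commutator_products_SucI[OF commutator_in_derived_set[OF assms], of \<one> 0] assms by simp

lemma commutator_products_add:
  assumes "g \<in> commutator_products m" "h \<in> commutator_products n"
  shows "g \<otimes> h \<in> commutator_products (m + n)"
  using assms(1)
proof (induction m arbitrary: g)
  case 0
  then show ?case using assms(2) commutator_products_closed by simp
next
  case (Suc m)
  obtain c k where ck: "c \<in> derived_set G (carrier G)" "k \<in> commutator_products m" "g = c \<otimes> k"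
    by (rule commutator_products_SucE[OF Suc.prems])
  have "c \<in> carrier G" using ck(1) derived_set_closed by (rule subsetD[rotated])
  then have "g \<otimes> h = c \<otimes> (k \<otimes> h)"
    using ck assms(2) commutator_products_closed by (simp add: m_assoc)
  then show ?case using commutator_products_SucI[OF ck(1) Suc.IH[OF ck(2)]] by simp
qed

lemma commutator_products_mono:
  assumes "g \<in> commutator_products m" "m \<le> n"
  shows "g \<in> commutator_products n"
proof -
  have "\<one> \<in> commutator_products k" for k
  proof (induction k)
    case (Suc k)
    show ?case using commutator_products_SucI[OF one_in_derived_set Suc] by simp
  qed simp
  from commutator_products_add[OF assms(1) this[of "n - m"]] show ?thesis
    using assms commutator_products_closed by simp
qed

lemma commutator_products_conj:
  assumes "g \<in> commutator_products n" "x \<in> carrier G"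
  shows "x \<otimes> g \<otimes> inv x \<in> commutator_products n"
  using assms(1)
proof (induction n arbitrary: g)
  case 0
  then show ?case using assms(2) by simp
next
  case (Suc n)
  obtain c h where ch: "c \<in> derived_set G (carrier G)" "h \<in> commutator_products n" "g = c \<otimes> h"
    by (rule commutator_products_SucE[OF Suc.prems])
  obtain a b where ab: "a \<in> carrier G" "b \<in> carrier G" "c = a \<otimes> b \<otimes> inv a \<otimes> inv b"
    using ch(1) by blast
  let ?a = "x \<otimes> a \<otimes> inv x" and ?b = "x \<otimes> b \<otimes> inv x"
  have "x \<otimes> g \<otimes> inv x = (?a \<otimes> ?b \<otimes> inv ?a \<otimes> inv ?b) \<otimes> (x \<otimes> h \<otimes> inv x)"
    using ab ch commutator_products_closed[OF ch(2)] assms(2)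
    by (simp add: m_assoc inv_mult_group)
  moreover have "?a \<otimes> ?b \<otimes> inv ?a \<otimes> inv ?b \<in> derived_set G (carrier G)"
    using ab assms(2) by (intro commutator_in_derived_set) simp_all
  ultimately show ?case using commutator_products_SucI Suc.IH[OF ch(2)] by simp
qed

lemma commutator_products_inv:
  assumes "g \<in> commutator_products n"
  shows "inv g \<in> commutator_products n"
  using assms
proof (induction n arbitrary: g)
  case (Suc n)
  obtain c h where ch: "c \<in> derived_set G (carrier G)" "h \<in> commutator_products n" "g = c \<otimes> h"
    by (rule commutator_products_SucE[OF Suc.prems])
  obtain a b where ab: "a \<in> carrier G" "b \<in> carrier G" "c = a \<otimes> b \<otimes> inv a \<otimes> inv b"
    using ch(1) by blast
  have "inv g = inv h \<otimes> (b \<otimes> a \<otimes> inv b \<otimes> inv a)"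
    using ab ch commutator_products_closed[OF ch(2)] by (simp add: m_assoc inv_mult_group)
  moreover have "b \<otimes> a \<otimes> inv b \<otimes> inv a \<in> commutator_products 1"
    using ab by (intro commutator_products_1)
  ultimately show ?case using commutator_products_add[OF Suc.IH[OF ch(2)]] by fastforce
qed simp

lemma comm_length_le_commutator_products: "g \<in> commutator_products n \<Longrightarrow> comm_length G g \<le> n"
  unfolding commutator_products_def using comm_length_le by blast

lemma in_commutator_products_comm_length:
  "g \<in> derived G (carrier G) \<Longrightarrow> g \<in> commutator_products (comm_length G g)"
  unfolding commutator_products_def using comm_length_witness by blast

text \<open>An upper bound on a distance given by commutator length. It also compares elements
  outside \<open>[G,G]\<close> that agree modulo \<open>[G,G]\<close>, such as
  \<open>(x y)^n\<close> and \<open>x^n y^n\<close>; conjugation invariance makes costs add up under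
  multiplication.\<close>

definition near :: "nat \<Rightarrow> 'a \<Rightarrow> 'a \<Rightarrow> bool" where
  "near n g h \<longleftrightarrow> g \<in> carrier G \<and> h \<in> carrier G \<and> g \<otimes> inv h \<in> commutator_products n"

lemma near_refl: "g \<in> carrier G \<Longrightarrow> near 0 g g"
  by (simp add: near_def)

lemma near_mono: "near m g h \<Longrightarrow> m \<le> n \<Longrightarrow> near n g h"
  by (auto simp: near_def intro: commutator_products_mono)

lemma near_sym: "near n g h \<Longrightarrow> near n h g"
  using commutator_products_inv[of "g \<otimes> inv h" n] by (auto simp: near_def inv_mult_group)

lemma near_trans: "near m g h \<Longrightarrow> near n h k \<Longrightarrow> near (m + n) g k"
  using commutator_products_add[of "g \<otimes> inv h" m "h \<otimes> inv k" n] by (auto simp: near_def m_assoc)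

lemma near_mult:
  assumes "near m g h" "near n g' h'"
  shows "near (m + n) (g \<otimes> g') (h \<otimes> h')"
proof -
  have "(g \<otimes> (g' \<otimes> inv h') \<otimes> inv g) \<otimes> (g \<otimes> inv h) \<in> commutator_products (n + m)"
    using assms by (intro commutator_products_add commutator_products_conj) (auto simp: near_def)
  then show ?thesis
    using assms by (auto simp: near_def m_assoc inv_mult_group add.commute)
qed

lemma near_one: "near n g \<one> \<longleftrightarrow> g \<in> commutator_products n"
  using commutator_products_closed[of g n] by (auto simp: near_def)

lemma near_commute: "g \<in> carrier G \<Longrightarrow> h \<in> carrier G \<Longrightarrow> near 1 (g \<otimes> h) (h \<otimes> g)"
  using commutator_products_1[of g h] by (simp add: near_def m_assoc inv_mult_group)

lemma near_conj: "g \<in> carrier G \<Longrightarrow> x \<in> carrier G \<Longrightarrow> near 1 (x \<otimes> g \<otimes> inv x) g"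
  using near_commute[of "x \<otimes> g" "inv x"] by (simp add: m_assoc[symmetric])

lemma near_pow_commute:
  fixes n :: nat
  assumes "g \<in> carrier G" "h \<in> carrier G"
  shows "near 1 ((g \<otimes> h) [^] n) ((h \<otimes> g) [^] n)"
  using near_conj[of "(h \<otimes> g) [^] n" g] conj_pow[of "h \<otimes> g" g n] assms
  by (simp add: m_assoc)

text \<open>Here \<open>x\<^sup>n y\<^sup>n (x y)\<^sup>2\<close> and \<open>x\<^sup>n\<^sup>+\<^sup>2 y\<^sup>n\<^sup>+\<^sup>2\<close> differ by a conjugate of
  \<open>(x\<^sup>-\<^sup>1 z x) \<cdot> (y x) z\<^sup>-\<^sup>1 (y x)\<^sup>-\<^sup>1\<close> with \<open>z = x\<^sup>-\<^sup>1 y\<^sup>n\<close>, a commutator.\<close>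

lemma near_pow_mult:
  fixes n :: nat
  assumes x: "x \<in> carrier G" and y: "y \<in> carrier G"
  shows "near (n div 2) ((x \<otimes> y) [^] n) (x [^] n \<otimes> y [^] n)"
proof (induction n rule: induct_nat_012)
  case (ge2 n)
  let ?z = "inv x \<otimes> y [^] n"
  have comm: "near 1 ((inv x \<otimes> ?z \<otimes> x) \<otimes> (y \<otimes> x \<otimes> inv ?z \<otimes> inv x \<otimes> inv y)) \<one>"
  proof -
    \<comment> \<open>With \<open>p = x^-1 y^-1 x^-1\<close> one has \<open>y x p = x^-1\<close>, so
      conjugating \<open>[p, z]\<close> by \<open>y x\<close> gives the wanted product.\<close>
    have "near 1 ((inv x \<otimes> inv y \<otimes> inv x) \<otimes> ?z \<otimes> inv (inv x \<otimes> inv y \<otimes> inv x) \<otimes> inv ?z) \<one>"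
      using x y unfolding near_one by (intro commutator_products_1) simp_all
    then have "near 1 ((y \<otimes> x) \<otimes> ((inv x \<otimes> inv y \<otimes> inv x) \<otimes> ?z \<otimes> inv (inv x \<otimes> inv y \<otimes> inv x) \<otimes> inv ?z)
        \<otimes> inv (y \<otimes> x)) \<one>"
      unfolding near_one using x y by (intro commutator_products_conj) simp_all
    then show ?thesis using x y by (simp add: m_assoc inv_mult_group)
  qed
  let ?X = "x [^] (n + 2)" and ?c = "(inv x \<otimes> ?z \<otimes> x) \<otimes> (y \<otimes> x \<otimes> inv ?z \<otimes> inv x \<otimes> inv y)"
  have Y: "y [^] (n + 2) = y \<otimes> y [^] n \<otimes> y"
    using nat_pow_Suc2[OF y, of n] by simp
  have "(x [^] n \<otimes> y [^] n \<otimes> (x \<otimes> y \<otimes> (x \<otimes> y))) \<otimes> inv (?X \<otimes> y [^] (n + 2)) = ?X \<otimes> ?c \<otimes> inv ?X"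
    unfolding Y using x y by (simp add: m_assoc inv_mult_group)
  then have "near 1 (x [^] n \<otimes> y [^] n \<otimes> (x \<otimes> y \<otimes> (x \<otimes> y))) (?X \<otimes> y [^] (n + 2))"
    using commutator_products_conj[of ?c 1 ?X] comm x y unfolding near_one
    by (simp only: near_def) simp
  moreover have "near (n div 2 + 0) ((x \<otimes> y) [^] n \<otimes> (x \<otimes> y \<otimes> (x \<otimes> y)))
      (x [^] n \<otimes> y [^] n \<otimes> (x \<otimes> y \<otimes> (x \<otimes> y)))"
    by (rule near_mult[OF ge2(1) near_refl]) (use x y in simp)
  ultimately have "near (n div 2 + 0 + 1) ((x \<otimes> y) [^] n \<otimes> (x \<otimes> y \<otimes> (x \<otimes> y))) (?X \<otimes> y [^] (n + 2))"
    by (rule near_trans[rotated])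
  then show ?case using x y by (simp add: m_assoc)
qed (use x y in \<open>auto intro: near_refl\<close>)

text \<open>Moving one factor past any prefix costs a single commutator. The total depends on the
  number of factors only, so permuting \<open>N\<close>-th powers costs the same for all
  \<open>N\<close>.\<close>

lemma near_foldr_permute:
  assumes "mset xs = mset ys" "set xs \<subseteq> carrier G"
  shows "near (length xs) (foldr (\<otimes>) xs \<one>) (foldr (\<otimes>) ys \<one>)"
  using assms
proof (induction xs arbitrary: ys)
  case Nil
  then show ?case by (simp add: near_refl)
next
  case (Cons x xs)
  have "x \<in> set ys" using Cons.prems(1) by (metis list.set_intros(1) set_mset_mset)
  then obtain us vs where ys: "ys = us @ x # vs" by (meson split_list)
  have eq: "mset xs = mset (us @ vs)" using Cons.prems(1) ys by simp
  have sub: "set us \<subseteq> carrier G" "set vs \<subseteq> carrier G" "x \<in> carrier G"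
    using Cons.prems(2) mset_eq_setD[OF eq] by auto
  let ?u = "foldr (\<otimes>) us \<one>" and ?v = "foldr (\<otimes>) vs \<one>"
  have uv: "?u \<in> carrier G" "?v \<in> carrier G" using sub foldr_mult_closed by auto
  have "near (length xs) (foldr (\<otimes>) xs \<one>) (?u \<otimes> ?v)"
    using Cons.IH[OF eq] Cons.prems(2) foldr_mult_append sub by simp
  then have "near (0 + length xs) (x \<otimes> foldr (\<otimes>) xs \<one>) (x \<otimes> (?u \<otimes> ?v))"
    by (rule near_mult[OF near_refl[OF sub(3)]])
  moreover have "near (1 + 0) ((x \<otimes> ?u) \<otimes> ?v) ((?u \<otimes> x) \<otimes> ?v)"
    by (intro near_mult near_commute near_refl uv sub)
  ultimately have "near (0 + length xs + (1 + 0)) (x \<otimes> foldr (\<otimes>) xs \<one>) ((?u \<otimes> x) \<otimes> ?v)"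
    using uv sub by (simp only: m_assoc near_trans m_closed)
  then show ?case
    using foldr_mult_append[of us "x # vs"] sub uv by (simp add: ys m_assoc)
qed

end

section \<open>Cancelling letters in chains of words\<close>

lemma concat_mset_cong: "mset L = mset L' \<Longrightarrow> mset (concat L) = mset (concat L')"
  by (metis mset_concat mset_map sum_mset_sum_list)

lemma split_list_inverse_pair:
  assumes "(x, True) \<in> set w" "(x, False) \<in> set w"
  obtains P Q R b where "w = P @ (x, b) # Q @ inv_letter (x, b) # R"
proof -
  obtain P Q where PQ: "w = P @ (x, True) # Q" using assms(1) by (meson split_list)
  then consider "(x, False) \<in> set P" | "(x, False) \<in> set Q" using assms(2) by auto
  then show thesis
  proof cases
    case 1
    then obtain P1 P2 where "P = P1 @ (x, False) # P2" by (meson split_list)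
    then show ?thesis using PQ by (intro that[of P1 False P2 Q]) (simp add: inv_letter_def)
  next
    case 2
    then obtain Q1 Q2 where "Q = Q1 @ (x, False) # Q2" by (meson split_list)
    then show ?thesis using PQ by (intro that[of P True Q1 Q2]) (simp add: inv_letter_def)
  qed
qed

definition exponent_sum :: "'x \<Rightarrow> 'x letter multiset \<Rightarrow> int" where
  "exponent_sum x M = int (count M (x, True)) - int (count M (x, False))"

lemma exponent_sum_0_member:
  assumes "exponent_sum x M = 0" "(x, b) \<in># M"
  shows "(x, c) \<in># M"
proof -
  have "count M (x, True) = count M (x, False)" using assms(1) by (simp add: exponent_sum_def)
  then have "count M (x, c) = count M (x, b)" by (cases b; cases c) simp_all
  then show ?thesis using assms(2) by (metis count_eq_zero_iff)
qed

context group
begin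

lemma word_eval_Cons:
  "range f \<subseteq> carrier G \<Longrightarrow> word_eval G f (l # w) = word_eval G f [l] \<otimes> word_eval G f w"
  using word_eval_closed[of f UNIV w] by (auto simp: word_eval_def image_subset_iff)

lemma word_eval_Nil [simp]: "word_eval G f [] = \<one>"
  by (simp add: word_eval_def)

lemma word_eval_in_carrier [simp]: "range f \<subseteq> carrier G \<Longrightarrow> word_eval G f w \<in> carrier G"
  using word_eval_closed[of f UNIV] by simp

lemma word_eval_append:
  assumes "range f \<subseteq> carrier G"
  shows "word_eval G f (u @ v) = word_eval G f u \<otimes> word_eval G f v"
proof (induction u)
  case (Cons l u)
  then show ?case
    using assms word_eval_Cons[OF assms, of l "u @ v"] word_eval_Cons[OF assms, of l u]
    by (simp add: m_assoc)
qed (use assms in simp)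

lemma word_eval_inv_letter:
  "range f \<subseteq> carrier G \<Longrightarrow> word_eval G f [inv_letter l] = inv (word_eval G f [l])"
  by (auto simp: word_eval_def image_subset_iff)

text \<open>The list plays the role of a formal sum of loops: order of the words and cyclic rotation
  within a word matter only up to a number of commutators independent of \<open>N\<close>.\<close>

definition power_product :: "('x \<Rightarrow> 'a) \<Rightarrow> nat \<Rightarrow> 'x letter list list \<Rightarrow> 'a" where
  "power_product f N L = foldr (\<otimes>) (map (\<lambda>w. word_eval G f w [^] N) L) \<one>"

text \<open>The coefficient of \<open>N\<close> is \<open>r/2\<close>: a chain version of \<open>scl \<le> r/2\<close>, uniform in the assignments \<open>A\<close>.\<close>

definition chain_bounded :: "('x \<Rightarrow> 'a) set \<Rightarrow> nat \<Rightarrow> 'x letter list list \<Rightarrow> bool" where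
  "chain_bounded A r L \<longleftrightarrow>
    (\<exists>C. \<forall>f\<in>A. \<forall>N. power_product f N L \<in> commutator_products ((r * N + C) div 2))"

lemma power_product_Cons:
  "power_product f N (w # L) = word_eval G f w [^] N \<otimes> power_product f N L"
  by (simp add: power_product_def)

lemma power_product_closed [simp]: "range f \<subseteq> carrier G \<Longrightarrow> power_product f N L \<in> carrier G"
  unfolding power_product_def by (rule foldr_mult_closed) auto

lemma chain_bounded_permute:
  assumes A: "\<And>f. f \<in> A \<Longrightarrow> range f \<subseteq> carrier G"
    and L: "chain_bounded A r L" "mset L = mset L'"
  shows "chain_bounded A r L'"
proof -
  obtain C where C: "\<And>f N. f \<in> A \<Longrightarrow> power_product f N L \<in> commutator_products ((r * N + C) div 2)"
    using L(1) unfolding chain_bounded_def by blast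
  have "power_product f N L' \<in> commutator_products ((r * N + (C + 2 * length L)) div 2)" if f: "f \<in> A" for f N
  proof -
    have "near (length L) (power_product f N L') (power_product f N L)"
      using near_foldr_permute[of "map (\<lambda>w. word_eval G f w [^] N) L'" "map (\<lambda>w. word_eval G f w [^] N) L"]
        A[OF f] L(2) mset_eq_length[OF L(2)] by (auto simp: power_product_def image_subset_iff)
    then have "near (length L + (r * N + C) div 2) (power_product f N L') \<one>"
      by (rule near_trans) (simp add: near_one C[OF f])
    then have "near ((r * N + (C + 2 * length L)) div 2) (power_product f N L') \<one>"
      by (rule near_mono) simp
    then show ?thesis by (simp only: near_one)
  qed
  then show ?thesis unfolding chain_bounded_def by blast
qed

lemma chain_bounded_step:
  assumes L: "chain_bounded A r L"
    and near: "\<And>f N. f \<in> A \<Longrightarrow> near (N div 2 + D) (power_product f N L') (power_product f N L)"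
  shows "chain_bounded A (Suc r) L'"
proof -
  obtain C where C: "\<And>f N. f \<in> A \<Longrightarrow> power_product f N L \<in> commutator_products ((r * N + C) div 2)"
    using L unfolding chain_bounded_def by blast
  have "power_product f N L' \<in> commutator_products ((Suc r * N + (C + 2 * D)) div 2)" if f: "f \<in> A" for f N
  proof -
    have "near (N div 2 + D + (r * N + C) div 2) (power_product f N L') \<one>"
      by (rule near_trans[OF near[OF f]]) (simp add: near_one C[OF f])
    then have "near ((Suc r * N + (C + 2 * D)) div 2) (power_product f N L') \<one>"
      by (rule near_mono) simp
    then show ?thesis by (simp only: near_one)
  qed
  then show ?thesis unfolding chain_bounded_def by blast
qed

text \<open>A cyclic rotation gives \<open>(x q x^-1)(r p)\<close>, to which
  \<open>near_pow_mult\<close> applies; rotating and undoing the conjugation by \<open>x\<close>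
  cost one commutator each, whatever \<open>N\<close> is.\<close>

lemma near_power_split:
  fixes N :: nat
  assumes "p \<in> carrier G" "x \<in> carrier G" "q \<in> carrier G" "r \<in> carrier G"
  shows "near (N div 2 + 3) ((p \<otimes> x \<otimes> q \<otimes> inv x \<otimes> r) [^] N) (q [^] N \<otimes> (r \<otimes> p) [^] N)"
proof -
  let ?y = "x \<otimes> q \<otimes> inv x"
  have "near 1 ((p \<otimes> (?y \<otimes> r)) [^] N) (((?y \<otimes> r) \<otimes> p) [^] N)"
    using assms by (intro near_pow_commute) simp_all
  moreover have "near (N div 2) ((?y \<otimes> (r \<otimes> p)) [^] N) (?y [^] N \<otimes> (r \<otimes> p) [^] N)"
    using assms by (intro near_pow_mult) simp_all
  moreover have "near (1 + 0) (?y [^] N \<otimes> (r \<otimes> p) [^] N) (q [^] N \<otimes> (r \<otimes> p) [^] N)"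
    using assms near_conj[of "q [^] N" x] by (intro near_mult near_refl) (simp_all add: conj_pow)
  ultimately have "near (1 + N div 2 + (1 + 0)) ((p \<otimes> (?y \<otimes> r)) [^] N) (q [^] N \<otimes> (r \<otimes> p) [^] N)"
    using assms by (simp only: m_assoc m_closed inv_closed) (blast intro: near_trans)
  then show ?thesis
    using assms by (intro near_mono[of "1 + N div 2 + (1 + 0)" _ _ "N div 2 + 3"]) (simp_all add: m_assoc)
qed

text \<open>Rotations move \<open>x\<close> to the end of the first word and \<open>x^-1\<close> to
  the front of the second, so they cancel once \<open>near_pow_mult\<close> merges the two
  powers.\<close>

lemma near_power_join:
  fixes N :: nat
  assumes "p \<in> carrier G" "x \<in> carrier G" "q \<in> carrier G" "r \<in> carrier G" "s \<in> carrier G"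
  shows "near (N div 2 + 2) ((p \<otimes> x \<otimes> q) [^] N \<otimes> (r \<otimes> inv x \<otimes> s) [^] N)
    ((q \<otimes> p \<otimes> s \<otimes> r) [^] N)"
proof -
  let ?y = "q \<otimes> (p \<otimes> x)" and ?z = "(inv x \<otimes> s) \<otimes> r"
  have "near (1 + 1) (((p \<otimes> x) \<otimes> q) [^] N \<otimes> (r \<otimes> (inv x \<otimes> s)) [^] N) (?y [^] N \<otimes> ?z [^] N)"
    using assms by (intro near_mult near_pow_commute) simp_all
  moreover have "near (N div 2) (?y [^] N \<otimes> ?z [^] N) ((?y \<otimes> ?z) [^] N)"
    using assms by (intro near_sym[OF near_pow_mult]) simp_all
  ultimately have "near (1 + 1 + N div 2) (((p \<otimes> x) \<otimes> q) [^] N \<otimes> (r \<otimes> (inv x \<otimes> s)) [^] N) ((?y \<otimes> ?z) [^] N)"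
    by (rule near_trans)
  then show ?thesis
    using assms by (simp add: m_assoc)
qed

lemma chain_bounded_split:
  assumes A: "\<And>f. f \<in> A \<Longrightarrow> range f \<subseteq> carrier G"
    and L: "chain_bounded A r ((P @ l # Q @ inv_letter l # R) # L)"
  shows "chain_bounded A (Suc r) (Q # (R @ P) # L)"
proof (rule chain_bounded_step[OF L])
  fix f N assume "f \<in> A"
  then have f: "range f \<subseteq> carrier G" by (rule A)
  let ?e = "word_eval G f"
  have "?e (P @ l # Q @ inv_letter l # R) = ?e P \<otimes> ?e [l] \<otimes> ?e Q \<otimes> inv ?e [l] \<otimes> ?e R"
    using f word_eval_Cons[OF f, of l "Q @ inv_letter l # R"] word_eval_Cons[OF f, of "inv_letter l" R]
    by (simp add: word_eval_append word_eval_inv_letter m_assoc)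
  then have "near (N div 2 + 3) (?e Q [^] N \<otimes> ?e (R @ P) [^] N) (?e (P @ l # Q @ inv_letter l # R) [^] N)"
    using near_sym[OF near_power_split[of "?e P" "?e [l]" "?e Q" "?e R" N]] f
    by (simp add: word_eval_append)
  then have "near (N div 2 + 3 + 0) ((?e Q [^] N \<otimes> ?e (R @ P) [^] N) \<otimes> power_product f N L)
      (?e (P @ l # Q @ inv_letter l # R) [^] N \<otimes> power_product f N L)"
    using f by (intro near_mult near_refl) simp_all
  then show "near (N div 2 + 3) (power_product f N (Q # (R @ P) # L))
      (power_product f N ((P @ l # Q @ inv_letter l # R) # L))"
    using f by (simp add: power_product_Cons m_assoc)
qed

lemma chain_bounded_join:
  assumes A: "\<And>f. f \<in> A \<Longrightarrow> range f \<subseteq> carrier G"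
    and L: "chain_bounded A r ((P @ l # Q) # (R @ inv_letter l # S) # L)"
  shows "chain_bounded A (Suc r) ((Q @ P @ S @ R) # L)"
proof (rule chain_bounded_step[OF L])
  fix f N assume "f \<in> A"
  then have f: "range f \<subseteq> carrier G" by (rule A)
  let ?e = "word_eval G f"
  have "?e (P @ l # Q) = ?e P \<otimes> ?e [l] \<otimes> ?e Q" "?e (R @ inv_letter l # S) = ?e R \<otimes> inv ?e [l] \<otimes> ?e S"
    using f word_eval_Cons[OF f, of l Q] word_eval_Cons[OF f, of "inv_letter l" S]
    by (simp_all add: word_eval_append word_eval_inv_letter m_assoc)
  then have "near (N div 2 + 2) (?e (Q @ P @ S @ R) [^] N) (?e (P @ l # Q) [^] N \<otimes> ?e (R @ inv_letter l # S) [^] N)"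
    using near_sym[OF near_power_join[of "?e P" "?e [l]" "?e Q" "?e R" "?e S" N]] f
    by (simp add: word_eval_append m_assoc)
  then have "near (N div 2 + 2 + 0) (?e (Q @ P @ S @ R) [^] N \<otimes> power_product f N L)
     ((?e (P @ l # Q) [^] N \<otimes> ?e (R @ inv_letter l # S) [^] N) \<otimes> power_product f N L)"
    using f by (intro near_mult near_refl) simp_all
  then show "near (N div 2 + 2) (power_product f N ((Q @ P @ S @ R) # L))
      (power_product f N ((P @ l # Q) # (R @ inv_letter l # S) # L))"
    using f by (simp add: power_product_Cons m_assoc)
qed

text \<open>Each step removes a letter other than \<open>z^\<plusminus>\<close> together with an
  inverse of it and raises \<open>r\<close> by one: by \<open>chain_bounded_split\<close> if both
  lie in one word, by \<open>chain_bounded_join\<close> otherwise. Exponent sums 0 provide the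
  partner; \<open>s\<close> counts the pairs.\<close>

lemma chain_bounded_eliminate:
  fixes A :: "('x \<Rightarrow> 'a) set"
  assumes A: "\<And>f. f \<in> A \<Longrightarrow> range f \<subseteq> carrier G"
    and "chain_bounded A r L"
    and "\<And>x. x \<noteq> z \<Longrightarrow> exponent_sum x (mset (concat L)) = 0"
    and "\<And>l. l \<in># mset (concat L) \<Longrightarrow> fst l = z \<Longrightarrow> snd l"
  shows "\<exists>s C. 2 * s = size {#l \<in># mset (concat L). fst l \<noteq> z#} \<and>
    (\<forall>f\<in>A. \<forall>N. f z [^] (N * size {#l \<in># mset (concat L). fst l = z#})
      \<in> commutator_products (((r + s) * N + C) div 2))"
  using assms(2-4)
proof (induction "size {#l \<in># mset (concat L). fst l \<noteq> z#}" arbitrary: r L rule: less_induct)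
  case less
  let ?M = "mset (concat L)"
  show ?case
  proof (cases "\<exists>l. l \<in># ?M \<and> fst l \<noteq> z")
    \<comment> \<open>Only positive letters \<open>z\<close> are left, so the power product is a
      single power of \<open>f z\<close>.\<close>
    case False
    then have all: "l = (z, True)" if "l \<in># ?M" for l
      using less.prems(3)[OF that] that by (cases l) auto
    have word: "word_eval G f w = f z [^] length w"
      if "f \<in> A" "set w \<subseteq> {(z, True)}" for f and w :: "'x letter list"
    proof -
      have "f z \<in> carrier G" using A[OF that(1)] by auto
      with that(2) show ?thesis
        by (induction w) (auto simp: word_eval_def simp flip: nat_pow_Suc2)
    qed
    have "power_product f N K = f z [^] (N * length (concat K))"
      if "f \<in> A" "set (concat K) \<subseteq> {(z, True)}" for f N and K :: "'x letter list list"
    proof -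
      have "f z \<in> carrier G" using A[OF that(1)] by auto
      with that(2) show ?thesis
        by (induction K)
          (auto simp: power_product_def word[OF that(1)] nat_pow_pow nat_pow_mult algebra_simps)
    qed
    moreover have "set (concat L) \<subseteq> {(z, True)}"
      using all by auto
    moreover have "{#l \<in># ?M. fst l \<noteq> z#} = {#}" "{#l \<in># ?M. fst l = z#} = ?M"
      using filter_mset_cong[of ?M ?M "\<lambda>l. fst l \<noteq> z" "\<lambda>_. False"]
        filter_mset_cong[of ?M ?M "\<lambda>l. fst l = z" "\<lambda>_. True"] all by fastforce+
    moreover obtain C where
      "\<forall>f\<in>A. \<forall>N. power_product f N L \<in> commutator_products ((r * N + C) div 2)"
      using less.prems(1) unfolding chain_bounded_def by blast
    ultimately show ?thesis
      by (intro exI[of _ 0] exI[of _ C]) auto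
  next
    case True
    then obtain x b where x: "x \<noteq> z" "(x, b) \<in># ?M" by auto
    then have xM: "(x, True) \<in># ?M" "(x, False) \<in># ?M"
      using exponent_sum_0_member[OF less.prems(2)] by blast+
    have step: ?thesis if L': "chain_bounded A (Suc r) L'" "?M = mset (concat L') + {#(x, c), (x, \<not> c)#}" for L' c
    proof -
      have "exponent_sum y (mset (concat L')) = exponent_sum y ?M" for y
        unfolding L'(2) by (cases c) (auto simp: exponent_sum_def)
      moreover have "l \<in># ?M" if "l \<in># mset (concat L')" for l
        using that unfolding L'(2) by simp
      moreover have size: "size {#l \<in># ?M. fst l \<noteq> z#} = 2 + size {#l \<in># mset (concat L'). fst l \<noteq> z#}"
        "size {#l \<in># ?M. fst l = z#} = size {#l \<in># mset (concat L'). fst l = z#}"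
        unfolding L'(2) using x(1) by simp_all
      ultimately obtain s C where "2 * s = size {#l \<in># mset (concat L'). fst l \<noteq> z#}"
        "\<forall>f\<in>A. \<forall>N. f z [^] (N * size {#l \<in># mset (concat L'). fst l = z#})
          \<in> commutator_products (((Suc r + s) * N + C) div 2)"
        using less.hyps[of L' "Suc r"] L'(1) less.prems(2,3) by auto
      then show ?thesis
        unfolding size by (intro exI[of _ "Suc s"] exI[of _ C]) simp
    qed
    obtain w1 where w1: "w1 \<in> set L" "(x, True) \<in> set w1" using xM(1) by auto
    then obtain L1 where L1: "mset L = mset (w1 # L1)"
      by (metis mset.simps(2) insert_DiffM set_mset_mset ex_mset)
    have chain1: "chain_bounded A r (w1 # L1)"
      by (rule chain_bounded_permute[OF A less.prems(1) L1])
    have M1: "?M = mset (concat (w1 # L1))"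
      by (rule concat_mset_cong[OF L1])
    show ?thesis
    proof (cases "(x, False) \<in> set w1")
      case True
      obtain P Q R c where w1_eq: "w1 = P @ (x, c) # Q @ inv_letter (x, c) # R"
        by (rule split_list_inverse_pair[OF w1(2) True])
      show ?thesis
      proof (rule step)
        show "chain_bounded A (Suc r) (Q # (R @ P) # L1)"
          using chain_bounded_split[OF A] chain1 unfolding w1_eq by blast
        show "?M = mset (concat (Q # (R @ P) # L1)) + {#(x, c), (x, \<not> c)#}"
          unfolding M1 w1_eq by (simp add: inv_letter_def)
      qed
    next
      case False
      then obtain w2 where w2: "w2 \<in> set L1" "(x, False) \<in> set w2"
        using xM(2) unfolding M1 by auto
      then obtain L2 where L2: "mset L1 = mset (w2 # L2)"
        by (metis mset.simps(2) insert_DiffM set_mset_mset ex_mset)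
      obtain P Q where w1_eq: "w1 = P @ (x, True) # Q" using w1(2) by (meson split_list)
      obtain R S where w2_eq: "w2 = R @ inv_letter (x, True) # S"
        using w2(2) by (auto simp: inv_letter_def dest: split_list)
      have L12: "mset (w1 # L1) = mset (w1 # w2 # L2)" using L2 by simp
      show ?thesis
      proof (rule step)
        show "chain_bounded A (Suc r) ((Q @ P @ S @ R) # L2)"
          using chain_bounded_join[OF A] chain_bounded_permute[OF A chain1 L12]
          unfolding w1_eq w2_eq by blast
        show "?M = mset (concat ((Q @ P @ S @ R) # L2)) + {#(x, True), (x, \<not> True)#}"
          unfolding M1 concat_mset_cong[OF L12] unfolding w1_eq w2_eq by (simp add: inv_letter_def)
      qed
    qed
  qed
qed

text \<open>For a trivial word the first cancellation costs O(1) instead of \<open>N/2\<close>, so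
  \<open>r\<close> is one less than the number of cancelled pairs. The \<open>max 2\<close> covers
  words without letters other than \<open>z\<close>, where \<open>r = 0\<close>.\<close>

lemma trivial_word_power_bound:
  fixes A :: "('x \<Rightarrow> 'a) set"
  assumes A: "\<And>f. f \<in> A \<Longrightarrow> range f \<subseteq> carrier G"
    and law: "\<And>f. f \<in> A \<Longrightarrow> word_eval G f v = \<one>"
    and exp: "\<And>x. x \<noteq> z \<Longrightarrow> exponent_sum x (mset v) = 0"
    and pos: "\<And>l. l \<in># mset v \<Longrightarrow> fst l = z \<Longrightarrow> snd l"
  shows "\<exists>r C. 2 * r + 2 \<le> max 2 (size {#l \<in># mset v. fst l \<noteq> z#}) \<and>
    (\<forall>f\<in>A. \<forall>N. f z [^] (N * size {#l \<in># mset v. fst l = z#})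
      \<in> commutator_products ((r * N + C) div 2))"
proof (cases "\<exists>l. l \<in># mset v \<and> fst l \<noteq> z")
  case False
  have "chain_bounded A 0 [v]"
    unfolding chain_bounded_def by (intro exI[of _ 0]) (simp add: power_product_def law)
  from chain_bounded_eliminate[OF A this, of z] exp pos
  obtain s C where "2 * s = size {#l \<in># mset v. fst l \<noteq> z#}"
    "\<forall>f\<in>A. \<forall>N. f z [^] (N * size {#l \<in># mset v. fst l = z#}) \<in> commutator_products (((0 + s) * N + C) div 2)"
    by auto
  moreover have "{#l \<in># mset v. fst l \<noteq> z#} = {#}"
    using False by (auto simp: filter_mset_eq_conv)
  ultimately show ?thesis by (intro exI[of _ 0] exI[of _ C]) simp
next
  case True
  then obtain x b where x: "x \<noteq> z" "(x, b) \<in># mset v" by auto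
  then have "(x, True) \<in> set v" "(x, False) \<in> set v"
    using exponent_sum_0_member[OF exp] by (metis set_mset_mset)+
  then obtain P Q R c where v: "v = P @ (x, c) # Q @ inv_letter (x, c) # R"
    by (rule split_list_inverse_pair)
  \<comment> \<open>Since \<open>v\<close> evaluates to \<one>, \<open>R P\<close> is conjugate to
    the inverse of \<open>Q\<close>, and \<open>Q^N (R P)^N\<close> is a single commutator.\<close>
  have "power_product f N [Q, R @ P] \<in> commutator_products ((0 * N + 2) div 2)" if f: "f \<in> A" for f N
  proof -
    let ?e = "word_eval G f" and ?x = "word_eval G f [(x, c)]"
    note f' = A[OF f]
    have e: "?e P \<in> carrier G" "?e Q \<in> carrier G" "?e R \<in> carrier G" "?x \<in> carrier G"
      using f' by auto
    have "?e P \<otimes> (?x \<otimes> (?e Q \<otimes> (inv ?x \<otimes> ?e R))) = \<one>"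
      using law[OF f] f' word_eval_Cons[OF f', of "(x, c)" "Q @ inv_letter (x, c) # R"]
        word_eval_Cons[OF f', of "inv_letter (x, c)" R]
      by (simp add: v word_eval_append word_eval_inv_letter)
    then have "?x \<otimes> (?e Q \<otimes> (inv ?x \<otimes> ?e R)) \<otimes> ?e P = \<one>"
      by (rule inv_comm) (use e in simp_all)
    then have "(?x \<otimes> ?e Q \<otimes> inv ?x) \<otimes> (?e R \<otimes> ?e P) = \<one>"
      using e by (simp add: m_assoc)
    then have "?e R \<otimes> ?e P = inv (?x \<otimes> ?e Q \<otimes> inv ?x)"
      by (intro inv_equality[symmetric] inv_comm[of "?x \<otimes> ?e Q \<otimes> inv ?x"]) (use e in simp_all)
    also have "\<dots> = ?x \<otimes> inv ?e Q \<otimes> inv ?x"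
      using e by (simp add: inv_mult_group m_assoc)
    finally have "?e (R @ P) [^] N = ?x \<otimes> inv ?e Q [^] N \<otimes> inv ?x"
      using e f' by (simp add: word_eval_append conj_pow)
    then have "near (0 + 1) (?e Q [^] N \<otimes> ?e (R @ P) [^] N) (?e Q [^] N \<otimes> inv ?e Q [^] N)"
      using e by (simp only:) (intro near_mult near_refl near_conj; simp)
    then show ?thesis
      using e f' by (simp add: power_product_def near_one nat_pow_inv)
  qed
  then have "chain_bounded A 0 [Q, R @ P]" unfolding chain_bounded_def by blast
  moreover have M: "mset v = mset (concat [Q, R @ P]) + {#(x, c), (x, \<not> c)#}"
    by (simp add: v inv_letter_def)
  have "exponent_sum y (mset (concat [Q, R @ P])) = exponent_sum y (mset v)" for y
    unfolding M by (cases c) (auto simp: exponent_sum_def)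
  moreover have "l \<in># mset v" if "l \<in># mset (concat [Q, R @ P])" for l
    using that unfolding M by simp
  moreover have size: "size {#l \<in># mset v. fst l \<noteq> z#} = 2 + size {#l \<in># mset (concat [Q, R @ P]). fst l \<noteq> z#}"
    "size {#l \<in># mset v. fst l = z#} = size {#l \<in># mset (concat [Q, R @ P]). fst l = z#}"
    unfolding M using x(1) by simp_all
  ultimately obtain s C where "2 * s = size {#l \<in># mset (concat [Q, R @ P]). fst l \<noteq> z#}"
    "\<forall>f\<in>A. \<forall>N. f z [^] (N * size {#l \<in># mset (concat [Q, R @ P]). fst l = z#})
      \<in> commutator_products (((0 + s) * N + C) div 2)"
    using chain_bounded_eliminate[of A 0 "[Q, R @ P]" z] A exp pos by auto
  then show ?thesis
    unfolding size by (intro exI[of _ s] exI[of _ C]) simp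
qed

end

section \<open>Pushing a loop to the boundary of the punctured torus\<close>

text \<open>The letters \<open>Some True\<close>, \<open>Some False\<close>, \<open>None\<close> stand for \<open>a\<close>, \<open>a b a\<^sup>-\<^sup>1\<close>, \<open>c = a b a\<^sup>-\<^sup>1 b\<^sup>-\<^sup>1\<close>.
  The table is read off from \<open>word_eval_corner\<close> below: \<open>corner x y\<close> spells \<open>p\<^sub>x x p\<^sub>y\<^sup>-\<^sup>1\<close>, where
  \<open>p\<^sub>x\<close> is the initial segment of \<open>c\<close> preceding the letter \<open>x\<close>. The spelling matters: among the words
  with this value it is chosen so that \<open>\<alpha>\<^sup>-\<^sup>1\<close> and \<open>\<beta>\<^sup>-\<^sup>1\<close> come with a \<open>c\<close>, except at the left turn
  from \<open>a\<close> to \<open>b\<^sup>-\<^sup>1\<close>. The pairs \<open>y = x\<^sup>-\<^sup>1\<close> are junk.\<close>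

fun corner :: "bool letter \<Rightarrow> bool letter \<Rightarrow> bool option letter list" where
  "corner (True, True) (True, True) = [(Some True, True)]"
| "corner (False, True) (False, True) = [(Some False, True)]"
| "corner (True, False) (True, False) = [(None, True), (Some True, False)]"
| "corner (False, False) (False, False) = [(None, True), (Some False, False)]"
| "corner (True, True) (False, False) = [(Some True, True), (Some False, False)]"
| "corner (False, True) (True, True) = [(Some False, True), (Some True, True)]"
| "corner (True, False) (False, True) = [(None, True), (Some True, False), (Some False, True)]"
| "corner (False, False) (True, False) = [(None, True), (Some False, False), (None, True), (Some True, False)]"
| "corner (False, False) (True, True) = [(None, True)]"
| "corner _ _ = []"

text \<open>A loop with letters \<open>x # w\<close> is passed as \<open>x # w\<close> followed by
  \<open>x\<close>; the repeated letter supplies the corner that closes the loop.\<close>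

fun corners :: "bool letter list \<Rightarrow> bool option letter list" where
  "corners (x # y # ys) = corner x y @ corners (y # ys)"
| "corners _ = []"

lemma corners_snoc: "corners (xs @ [x, y]) = corners (xs @ [x]) @ corner x y"
  by (induction xs rule: corners.induct) auto

lemma corners_positive: "l \<in> set (corners p) \<Longrightarrow> fst l = None \<Longrightarrow> snd l"
proof (induction p rule: corners.induct)
  case (1 x y ys)
  have "l \<in> set (corner x y) \<Longrightarrow> fst l = None \<Longrightarrow> snd l"
    by (cases "(x, y)" rule: corner.cases) auto
  then show ?case using 1 by auto
qed auto

lemma exponent_sum_add [simp]: "exponent_sum x (M + N) = exponent_sum x M + exponent_sum x N"
  by (simp add: exponent_sum_def)

text \<open>Minus the exponent of the generator \<open>g\<close> in the prefix
  \<open>p\<^sub>x\<close> of the letter \<open>x\<close>: abelianising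
  \<open>p\<^sub>x x p\<^sub>y\<^sup>-\<^sup>1\<close>, where \<open>c\<close> vanishes, gives
  \<open>exponent_sum_corner\<close>.\<close>

fun exponent_shift :: "bool \<Rightarrow> bool letter \<Rightarrow> int" where
  "exponent_shift g (True, True) = 0"
| "exponent_shift g (False, True) = (if g then - 1 else 0)"
| "exponent_shift g (True, False) = - 1"
| "exponent_shift g (False, False) = (if g then 0 else - 1)"

lemma exponent_sum_corner:
  assumes "y \<noteq> inv_letter x"
  shows "exponent_sum (Some g) (mset (corner x y)) = exponent_sum g {#x#} + exponent_shift g y - exponent_shift g x"
  using assms
  by (cases "(x, y)" rule: corner.cases; cases g) (auto simp: exponent_sum_def inv_letter_def)

text \<open>The shifts telescope and cancel on a closed path, so the corners inherit the exponent
  sums of the loop.\<close>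

lemma exponent_sum_corners:
  assumes "reduced (x # ys @ [z])"
  shows "exponent_sum (Some g) (mset (corners (x # ys @ [z]))) =
    exponent_sum g (mset (x # ys)) + exponent_shift g z - exponent_shift g x"
  using assms
proof (induction ys arbitrary: x)
  case Nil
  then show ?case by (simp add: exponent_sum_corner reduced_Cons)
next
  case (Cons y ys)
  have "exponent_sum g (mset (x # y # ys)) = exponent_sum g {#x#} + exponent_sum g (mset (y # ys))"
    by (simp add: exponent_sum_def)
  then show ?case
    using Cons by (simp add: exponent_sum_corner reduced_Cons del: mset.simps(2))
qed

text \<open>For a closed path with exponent sums 0, the excess of its corners is half the number of right
  turns minus left turns; hence it changes sign under inversion.\<close>

definition excess :: "bool option letter list \<Rightarrow> int" where
  "excess w = 2 * int (size {#l \<in># mset w. fst l = None#}) - int (size {#l \<in># mset w. fst l \<noteq> None#})"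

lemma excess_append [simp]: "excess (u @ v) = excess u + excess v"
  by (simp add: excess_def)

fun excess_shift :: "bool letter \<Rightarrow> int" where
  "excess_shift (True, b) = 0"
| "excess_shift (False, b) = (if b then 2 else - 2)"

lemma excess_corner_inverse:
  assumes "y \<noteq> inv_letter x"
  shows "excess (corner x y) + excess (corner (inv_letter y) (inv_letter x)) = excess_shift y - excess_shift x"
  using assms
  by (cases "(x, y)" rule: corner.cases) (auto simp: excess_def inv_letter_def)

text \<open>Inversion reverses the corners, and the potentials \<open>excess_shift\<close>
  telescope. For \<open>z = x\<close> the two excesses are negatives of each other, so a loop or its
  inverse has excess at least 0.\<close>

lemma excess_corners_inverse:
  assumes "reduced (x # ys @ [z])"
  shows "excess (corners (x # ys @ [z])) + excess (corners (rev (map inv_letter (x # ys @ [z])))) =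
    excess_shift z - excess_shift x"
  using assms
proof (induction ys arbitrary: x)
  case Nil
  then show ?case using excess_corner_inverse[of z x] by (simp add: reduced_Cons excess_def)
next
  case (Cons y ys)
  have "corners (rev (map inv_letter (x # (y # ys) @ [z]))) =
      corners (rev (map inv_letter (y # ys @ [z]))) @ corner (inv_letter y) (inv_letter x)"
    using corners_snoc[of "rev (map inv_letter (ys @ [z]))" "inv_letter y" "inv_letter x"] by simp
  moreover have "reduced (y # ys @ [z])" "y \<noteq> inv_letter x"
    using Cons.prems by (simp_all add: reduced_Cons)
  ultimately show ?case
    using Cons.IH[of y] excess_corner_inverse[of y x] by simp
qed

text \<open>The position of the letter in the boundary word \<open>a b a^-1 b^-1\<close>.\<close>

fun phase :: "bool letter \<Rightarrow> nat" where
  "phase (True, True) = 0"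
| "phase (False, True) = 1"
| "phase (True, False) = 2"
| "phase (False, False) = 3"

text \<open>For reduced pairs, an empty corner is a step to the next letter of the boundary word and
  increases \<open>phase\<close>; a closed path cannot consist of such steps alone.\<close>

lemma corners_nonempty:
  assumes "reduced (x # ys @ [z])" "phase z \<le> phase x"
  shows "corners (x # ys @ [z]) \<noteq> []"
proof -
  have corner: "phase u < phase v" if "v \<noteq> inv_letter u" "corner u v = []" for u v
    using that by (cases "(u, v)" rule: corner.cases) (auto simp: inv_letter_def)
  have "phase x < phase z" if "corners (x # ys @ [z]) = []"
    using assms(1) that
  proof (induction ys arbitrary: x)
    case Nil
    then show ?case by (simp add: corner reduced_Cons)
  next
    case (Cons y ys)
    then show ?case using corner[of y x] by (fastforce simp: reduced_Cons)
  qed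
  then show ?thesis using assms(2) by auto
qed

context group
begin

fun prefix :: "'a \<Rightarrow> 'a \<Rightarrow> bool letter \<Rightarrow> 'a" where
  "prefix a b (True, True) = \<one>"
| "prefix a b (False, True) = a"
| "prefix a b (True, False) = a \<otimes> b"
| "prefix a b (False, False) = a \<otimes> b \<otimes> inv a"

abbreviation generators :: "'a \<Rightarrow> 'a \<Rightarrow> bool \<Rightarrow> 'a" where
  "generators a b x \<equiv> if x then a else b"

definition corner_generators :: "'a \<Rightarrow> 'a \<Rightarrow> bool option \<Rightarrow> 'a" where
  "corner_generators a b x = (case x of None \<Rightarrow> a \<otimes> b \<otimes> inv a \<otimes> inv b | Some y \<Rightarrow> if y then a else a \<otimes> b \<otimes> inv a)"

lemma range_generators: "a \<in> carrier G \<Longrightarrow> b \<in> carrier G \<Longrightarrow> range (generators a b) \<subseteq> carrier G"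
  by auto

lemma range_corner_generators:
  "a \<in> carrier G \<Longrightarrow> b \<in> carrier G \<Longrightarrow> range (corner_generators a b) \<subseteq> carrier G"
  by (auto simp: corner_generators_def split: option.split)

lemma prefix_closed [simp]: "a \<in> carrier G \<Longrightarrow> b \<in> carrier G \<Longrightarrow> prefix a b x \<in> carrier G"
  by (cases "(a, b, x)" rule: prefix.cases) auto

lemma word_eval_corner:
  assumes "a \<in> carrier G" "b \<in> carrier G" "y \<noteq> inv_letter x"
  shows "word_eval G (corner_generators a b) (corner x y) =
    prefix a b x \<otimes> word_eval G (generators a b) [x] \<otimes> inv (prefix a b y)"
  using assms
  by (cases "(x, y)" rule: corner.cases)
    (auto simp: inv_letter_def word_eval_def corner_generators_def m_assoc inv_mult_group)

text \<open>Neighbouring prefixes cancel. For \<open>z = x\<close> the corners spell a conjugate of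
  the loop's value, so they are trivial whenever the loop is.\<close>

lemma word_eval_corners:
  assumes ab: "a \<in> carrier G" "b \<in> carrier G" and red: "reduced (x # ys @ [z])"
  shows "word_eval G (corner_generators a b) (corners (x # ys @ [z])) =
    prefix a b x \<otimes> word_eval G (generators a b) (x # ys) \<otimes> inv (prefix a b z)"
  using red
proof (induction ys arbitrary: x)
  case Nil
  then show ?case
    using word_eval_corner[OF ab, of z x] by (simp add: reduced_Cons)
next
  case (Cons y ys)
  let ?c = "word_eval G (corner_generators a b)" and ?e = "word_eval G (generators a b)"
  note g = range_generators[OF ab] and c = range_corner_generators[OF ab]
  have "?c (corners (x # (y # ys) @ [z])) = ?c (corner x y) \<otimes> ?c (corners (y # ys @ [z]))"
    using word_eval_append[OF c] by simp
  also have "\<dots> = (prefix a b x \<otimes> ?e [x] \<otimes> inv (prefix a b y)) \<otimes> (prefix a b y \<otimes> ?e (y # ys) \<otimes> inv (prefix a b z))"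
    using Cons word_eval_corner[OF ab, of y x] by (simp add: reduced_Cons)
  also have "\<dots> = prefix a b x \<otimes> (?e [x] \<otimes> ?e (y # ys)) \<otimes> inv (prefix a b z)"
    using ab word_eval_in_carrier[OF g] by (simp add: m_assoc)
  also have "?e [x] \<otimes> ?e (y # ys) = ?e (x # y # ys)"
    using word_eval_Cons[OF g, of x "y # ys"] by simp
  finally show ?case .
qed

lemma commutator_power_bound_excess:
  assumes red: "reduced (x # w @ [x])"
    and law: "\<And>a b. a \<in> carrier G \<Longrightarrow> b \<in> carrier G \<Longrightarrow> word_eval G (generators a b) (x # w) = \<one>"
    and exp: "\<And>g. exponent_sum g (mset (x # w)) = 0"
    and excess: "excess (corners (x # w @ [x])) \<ge> 0"
  shows "\<exists>n m. 2 \<le> n \<and> 2 * m < n \<and>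
    (\<forall>a\<in>carrier G. \<forall>b\<in>carrier G. (a \<otimes> b \<otimes> inv a \<otimes> inv b) [^] n \<in> commutator_products m)"
proof -
  let ?v = "corners (x # w @ [x])"
  let ?A = "(\<lambda>(a, b). corner_generators a b) ` (carrier G \<times> carrier G)"
  let ?K = "size {#l \<in># mset ?v. fst l = None#}" and ?M = "size {#l \<in># mset ?v. fst l \<noteq> None#}"
  have "\<exists>r C. 2 * r + 2 \<le> max 2 ?M \<and>
    (\<forall>f\<in>?A. \<forall>N. f None [^] (N * ?K) \<in> commutator_products ((r * N + C) div 2))"
  proof (rule trivial_word_power_bound)
    show "range f \<subseteq> carrier G" if "f \<in> ?A" for f
      using that range_corner_generators by auto
    show "word_eval G f ?v = \<one>" if "f \<in> ?A" for f
      using that word_eval_corners[OF _ _ red] law by auto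
    show "exponent_sum y (mset ?v) = 0" if "y \<noteq> None" for y
      using that exponent_sum_corners[OF red] exp by (cases y) auto
    show "snd l" if "l \<in># mset ?v" "fst l = None" for l
      using corners_positive that by simp
  qed
  then obtain r C where "2 * r + 2 \<le> max 2 ?M"
    "\<forall>f\<in>?A. \<forall>N. f None [^] (N * ?K) \<in> commutator_products ((r * N + C) div 2)"
    by blast
  then have r: "2 * r + 2 \<le> max 2 ?M"
    "\<And>a b N. a \<in> carrier G \<Longrightarrow> b \<in> carrier G \<Longrightarrow>
      (a \<otimes> b \<otimes> inv a \<otimes> inv b) [^] (N * ?K) \<in> commutator_products ((r * N + C) div 2)"
    by (auto simp: corner_generators_def)
  have "length ?v = ?K + ?M"
    by (metis multiset_partition size_mset size_union)
  moreover have "length ?v > 0" using corners_nonempty[OF red] by simp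
  moreover have "?M \<le> 2 * ?K" using excess unfolding excess_def by linarith
  \<comment> \<open>Nonnegative excess and a nonempty \<open>?v\<close> force \<open>?K\<close> to
    be positive, which settles the case \<open>?M \<le> 2\<close>; otherwise
    \<open>2 * r + 2 \<le> ?M \<le> 2 * ?K\<close>.\<close>
  ultimately have K: "Suc r \<le> ?K" using r(1) by linarith
  \<comment> \<open>Exceeding \<open>C\<close> absorbs the additive error and gives
    \<open>2 * m < n\<close>; being at least 2 also gives \<open>2 \<le> n\<close>.\<close>
  let ?N = "C + 2"
  have "Suc r * ?N \<le> ?K * ?N" using K by (rule mult_right_mono) simp
  then have "2 * ((r * ?N + C) div 2) < ?N * ?K" by (simp add: algebra_simps)
  moreover have "2 \<le> ?N * ?K" using K by (cases ?K) auto
  ultimately show ?thesis using r(2)[of _ _ ?N] by blast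
qed

end

section \<open>A uniform bound on powers of commutators from a two-generator law\<close>

context group
begin

lemma word_eval_inverse:
  assumes f: "range f \<subseteq> carrier G"
  shows "word_eval G f (rev (map inv_letter w)) = inv (word_eval G f w)"
proof (induction w)
  case (Cons l w)
  then show ?case
    using f word_eval_Cons[OF f, of l w]
    by (simp add: word_eval_append word_eval_inv_letter inv_mult_group)
qed simp

lemma word_eval_generators_one:
  assumes a: "a \<in> carrier G"
  shows "word_eval G (generators a \<one>) w = a [^] exponent_sum True (mset w)"
    and "word_eval G (generators \<one> a) w = a [^] exponent_sum False (mset w)"
proof -
  have Suc: "a \<otimes> a [^] k = a [^] (1 + k)" "inv a \<otimes> a [^] k = a [^] (k - 1)" for k :: int
    using a int_pow_mult[OF a, of 1 k] int_pow_mult[OF a, of "- 1" k]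
    by (simp_all add: int_pow_neg)
  have cons: "exponent_sum x (mset (l # w)) = exponent_sum x (mset w)
      + (if fst l = x then if snd l then 1 else - 1 else 0)" for x l and w :: "bool letter list"
    by (cases l) (auto simp: exponent_sum_def)
  show "word_eval G (generators a \<one>) w = a [^] exponent_sum True (mset w)"
  proof (induction w)
    case (Cons l w)
    show ?case
      unfolding word_eval_Cons[OF range_generators[OF a one_closed], of l w] Cons cons
      using a Suc by (auto simp: word_eval_def add.commute)
  qed (simp add: exponent_sum_def)
  show "word_eval G (generators \<one> a) w = a [^] exponent_sum False (mset w)"
  proof (induction w)
    case (Cons l w)
    show ?case
      unfolding word_eval_Cons[OF range_generators[OF one_closed a], of l w] Cons cons
      using a Suc by (auto simp: word_eval_def add.commute)
  qed (simp add: exponent_sum_def)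
qed

definition two_generator_law :: "bool letter list \<Rightarrow> bool" where
  "two_generator_law v \<longleftrightarrow>
    (\<forall>a\<in>carrier G. \<forall>b\<in>carrier G. word_eval G (generators a b) v = \<one>)"

text \<open>Setting the other generator to \<one> leaves a power of \<open>a\<close>, so a nonzero
  exponent sum bounds the exponent of \<open>G\<close>.\<close>

lemma two_generator_law_exponent:
  assumes v: "two_generator_law v" and a: "a \<in> carrier G"
  shows "a [^] nat \<bar>exponent_sum g (mset v)\<bar> = \<one>"
proof -
  have *: "a [^] exponent_sum g (mset v) = \<one>"
    using v word_eval_generators_one[OF a, of v] a by (cases g) (auto simp: two_generator_law_def)
  then have "a [^] \<bar>exponent_sum g (mset v)\<bar> = \<one>"
    using a by (auto simp: abs_if int_pow_neg)
  then show ?thesis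
    by (simp flip: int_pow_int)
qed

lemma commutator_power_bound:
  assumes "v \<noteq> []" and red: "reduced (v @ [hd v])" and law: "two_generator_law v"
  shows "\<exists>n m. 2 \<le> n \<and> 2 * m < n \<and>
    (\<forall>a\<in>carrier G. \<forall>b\<in>carrier G. (a \<otimes> b \<otimes> inv a \<otimes> inv b) [^] n \<in> commutator_products m)"
proof (cases "\<forall>g. exponent_sum g (mset v) = 0")
  case False
  then obtain g where g: "exponent_sum g (mset v) \<noteq> 0" by auto
  define k where "k = nat \<bar>exponent_sum g (mset v)\<bar>"
  have "k > 0" using g by (simp add: k_def)
  \<comment> \<open>Doubling \<open>k\<close> secures \<open>2 \<le> n\<close>.\<close>
  moreover have "c [^] (k * 2) = \<one>" if "c \<in> carrier G" for c
    using two_generator_law_exponent[OF law that, of g] that by (simp add: k_def flip: nat_pow_pow)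
  ultimately show ?thesis by (intro exI[of _ "k * 2"] exI[of _ 0]) simp
next
  case exp: True
  obtain x w where v: "v = x # w" using assms(1) by (cases v) auto
  let ?p = "x # w @ [x]" and ?w = "rev (map inv_letter w)"
  have red: "reduced ?p" using red by (simp add: v)
  have inv_p: "rev (map inv_letter ?p) = inv_letter x # ?w @ [inv_letter x]" by simp
  have "excess (corners ?p) + excess (corners (inv_letter x # ?w @ [inv_letter x])) = 0"
    using excess_corners_inverse[OF red] unfolding inv_p by simp
  then consider "excess (corners ?p) \<ge> 0" | "excess (corners (inv_letter x # ?w @ [inv_letter x])) \<ge> 0"
    by linarith
  then show ?thesis
  proof cases
    case 1
    then show ?thesis
      using law exp by (intro commutator_power_bound_excess[OF red]) (auto simp: two_generator_law_def v)
  next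
    case 2
    show ?thesis
    proof (rule commutator_power_bound_excess[OF _ _ _ 2])
      show "reduced (inv_letter x # ?w @ [inv_letter x])"
        using reduced_inverse[OF red] unfolding inv_p .
      show "word_eval G (generators a b) (inv_letter x # ?w) = \<one>"
        if ab: "a \<in> carrier G" "b \<in> carrier G" for a b
      proof -
        note g = range_generators[OF ab]
        let ?e = "word_eval G (generators a b)"
        have "?e [x] \<otimes> ?e w = \<one>"
          using law ab word_eval_Cons[OF g, of x w] by (auto simp: two_generator_law_def v)
        then have "inv ?e w = ?e [x]"
          by (intro inv_equality) (use word_eval_in_carrier[OF g] in simp_all)
        moreover have "?e (inv_letter x # ?w) = inv ?e [x] \<otimes> inv ?e w"
          using word_eval_Cons[OF g, of "inv_letter x" ?w] word_eval_inverse[OF g, of w]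
            word_eval_inv_letter[OF g, of x] by simp
        ultimately show ?thesis using word_eval_in_carrier[OF g, of "[x]"] by simp
      qed
      have "exponent_sum g (mset (map inv_letter u)) = - exponent_sum g (mset u)" for g and u :: "bool letter list"
        by (induction u) (auto simp: exponent_sum_def inv_letter_def split: prod.splits)
      from this[of _ "x # w"] show "exponent_sum g (mset (inv_letter x # ?w)) = 0" for g
        using exp by (simp add: v)
    qed
  qed
qed

text \<open>If the last letter is inverse to the first, both are stripped: this only conjugates the
  values, so the law persists, and reducedness keeps the remainder nonempty.\<close>

lemma cyclically_reduced_law:
  assumes "v \<noteq> []" "reduced v" "two_generator_law v"
  shows "\<exists>u. u \<noteq> [] \<and> reduced (u @ [hd u]) \<and> two_generator_law u"
  using assms
proof (induction v rule: length_induct)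
  case (1 v)
  obtain x w where v: "v = x # w" using "1.prems"(1) by (cases v) auto
  show ?case
  proof (cases "reduced (v @ [hd v])")
    case False
    then have "w \<noteq> []" by (auto simp: v reduced_Cons)
    then obtain u y where w: "w = u @ [y]" by (metis rev_exhaust)
    have "reduced ((x # u @ [y]) @ [x]) \<longleftrightarrow> reduced (x # u @ [y]) \<and> x \<noteq> inv_letter y"
      unfolding reduced_def successively_append_iff by simp
    then have y: "y = inv_letter x"
      using False "1.prems"(2) inv_letter_eq_iff[of x y] by (simp add: v w)
    have "u \<noteq> []" using "1.prems"(2) y by (auto simp: v w reduced_Cons)
    moreover have "reduced (u @ [y])" using "1.prems"(2) by (simp add: v w reduced_Cons)
    then have "reduced u" by (simp add: reduced_def successively_append_iff)
    ultimately have u: "u \<noteq> []" "reduced u" .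
    have "word_eval G (generators a b) u = \<one>" if ab: "a \<in> carrier G" "b \<in> carrier G" for a b
    proof -
      note g = range_generators[OF ab]
      let ?e = "word_eval G (generators a b)"
      have e: "?e [x] \<in> carrier G" "?e u \<in> carrier G" using word_eval_in_carrier[OF g] by auto
      have "?e [x] \<otimes> (?e u \<otimes> inv ?e [x]) = \<one>"
        using "1.prems"(3) ab word_eval_Cons[OF g, of x w] word_eval_append[OF g, of u "[y]"]
          word_eval_inv_letter[OF g, of x]
        by (auto simp: two_generator_law_def v w y)
      then have "inv ?e [x] \<otimes> (?e [x] \<otimes> (?e u \<otimes> inv ?e [x])) \<otimes> ?e [x] = inv ?e [x] \<otimes> \<one> \<otimes> ?e [x]"
        by simp
      then show ?thesis using e by (simp add: m_assoc)
    qed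
    then have "two_generator_law u" by (auto simp: two_generator_law_def)
    with u show ?thesis using "1.IH"[rule_format, of u] by (simp add: v w)
  qed (use "1.prems" in blast)
qed

end

section \<open>Reduction to two generators\<close>

text \<open>The word below is obtained by substituting \<open>a\<^sup>i b a\<^sup>-\<^sup>i\<close> for the \<open>i\<close>-th generator, merging adjacent
  powers of \<open>a\<close>; \<open>k\<close> is the index of the generator preceding the remaining word.\<close>

definition generator_power :: "int \<Rightarrow> bool letter list" where
  "generator_power k = replicate (nat \<bar>k\<bar>) (True, k \<ge> 0)"

fun two_generator_word :: "('x \<Rightarrow> int) \<Rightarrow> int \<Rightarrow> 'x letter list \<Rightarrow> bool letter list" where
  "two_generator_word i k [] = generator_power (- k)"
| "two_generator_word i k (l # w) =
    generator_power (i (fst l) - k) @ (False, snd l) # two_generator_word i (i (fst l)) w"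

lemma reduced_generator_power_append:
  assumes "reduced ((False, s) # u)"
  shows "reduced (generator_power k @ (False, s) # u)"
proof -
  have "reduced (replicate n (True, c) @ (False, s) # u)" for n c
    by (induction n) (use assms in \<open>auto simp: reduced_Cons inv_letter_def hd_append\<close>)
  then show ?thesis by (simp add: generator_power_def)
qed

text \<open>Two \<open>b\<close>-letters become adjacent only when their generators have the same
  index, hence are equal by injectivity; reducedness of the original word then forces equal
  signs.\<close>

lemma reduced_two_generator_word:
  assumes "reduced (l # w)" "inj_on i (fst ` set (l # w))"
  shows "reduced ((False, snd l) # two_generator_word i (i (fst l)) w)"
  using assms
proof (induction w arbitrary: l)
  case Nil
  have "reduced (replicate n (True, c))" for n c
    by (induction n) (auto simp: reduced_Cons inv_letter_def hd_replicate)
  then show ?case by (auto simp: generator_power_def reduced_Cons inv_letter_def hd_replicate)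
next
  case (Cons l' w)
  let ?u = "two_generator_word i (i (fst l')) w" and ?k = "i (fst l') - i (fst l)"
  have IH: "reduced ((False, snd l') # ?u)"
    by (intro Cons.IH inj_on_subset[OF Cons.prems(2)]) (use Cons.prems(1) in \<open>auto simp: reduced_Cons\<close>)
  have "snd l' = snd l" if "?k = 0"
  proof -
    have "fst l' = fst l" by (rule inj_onD[OF Cons.prems(2)]) (use that in auto)
    then show ?thesis using Cons.prems(1) by (simp add: reduced_Cons inv_letter_def prod_eq_iff)
  qed
  then have "hd (generator_power ?k @ (False, snd l') # ?u) \<noteq> inv_letter (False, snd l)"
    by (cases "?k = 0") (auto simp: generator_power_def inv_letter_def hd_append hd_replicate)
  then show ?case
    using reduced_generator_power_append[OF IH, of ?k] by (simp add: reduced_Cons)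
qed

context group
begin

lemma word_eval_generator_power:
  assumes "a \<in> carrier G" "b \<in> carrier G"
  shows "word_eval G (generators a b) (generator_power k) = a [^] k"
proof -
  have "word_eval G (generators a b) (replicate n (True, c)) = (if c then a else inv a) [^] n" for n c
    by (induction n) (use assms in \<open>auto simp: word_eval_def simp flip: nat_pow_Suc2\<close>)
  moreover have "inv a [^] nat (- k) = a [^] k" if "k < 0"
    using that assms int_pow_def2[of G a k] by (simp only: nat_pow_inv if_True)
  moreover have "a [^] nat k = a [^] k" if "k \<ge> 0"
    using that int_pow_def2[of G a k] by simp
  ultimately show ?thesis by (simp add: generator_power_def)
qed

lemma word_eval_two_generator_word:
  assumes ab: "a \<in> carrier G" "b \<in> carrier G"
  shows "word_eval G (generators a b) (two_generator_word i k w) =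
    a [^] (- k) \<otimes> word_eval G (\<lambda>x. a [^] i x \<otimes> b \<otimes> inv (a [^] i x)) w"
proof (induction w arbitrary: k)
  case Nil
  then show ?case using ab word_eval_generator_power[OF ab] by simp
next
  case (Cons l w)
  let ?h = "\<lambda>x. a [^] i x \<otimes> b \<otimes> inv (a [^] i x)" and ?e = "word_eval G (generators a b)"
  note g = range_generators[OF ab]
  have h: "range ?h \<subseteq> carrier G" using ab by auto
  have b: "?e [(False, snd l)] \<in> carrier G" using word_eval_in_carrier[OF g] .
  have l: "word_eval G ?h [l] = a [^] i (fst l) \<otimes> ?e [(False, snd l)] \<otimes> inv (a [^] i (fst l))"
    using ab by (auto simp: word_eval_def inv_mult_group m_assoc)
  have "?e (two_generator_word i k (l # w)) =
      a [^] (i (fst l) - k) \<otimes> (?e [(False, snd l)] \<otimes> (a [^] (- i (fst l)) \<otimes> word_eval G ?h w))"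
    using word_eval_append[OF g] word_eval_generator_power[OF ab] Cons
      word_eval_Cons[OF g, of "(False, snd l)" "two_generator_word i (i (fst l)) w"] by simp
  also have "a [^] (i (fst l) - k) = a [^] (- k) \<otimes> a [^] i (fst l)"
    using int_pow_mult[OF ab(1), of "- k" "i (fst l)"] by simp
  finally show ?case
    using ab b word_eval_in_carrier[OF h] word_eval_Cons[OF h, of l w] l
    by (simp add: int_pow_neg m_assoc)
qed

text \<open>The elements \<open>a^i b a^-i\<close> freely generate a subgroup of the free group on
  \<open>a, b\<close>. Indices are injective on the finitely many generators occurring in
  \<open>w\<close>, so the basis may have any cardinality.\<close>

lemma two_generator_law_exists:
  fixes w :: "'x letter list"
  assumes w: "w \<noteq> []" "reduced w"
    and law: "\<And>f. range f \<subseteq> carrier G \<Longrightarrow> word_eval G f w = \<one>"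
  shows "\<exists>v. v \<noteq> [] \<and> reduced v \<and> two_generator_law v"
proof -
  obtain j :: "'x \<Rightarrow> nat" where j: "inj_on j (fst ` set w)"
    using finite_imp_inj_to_nat_seg[of "fst ` set w"] by auto
  define i where "i x = int (j x)" for x
  have i: "inj_on i (fst ` set w)" using j by (auto simp: inj_on_def i_def)
  obtain l u where lu: "w = l # u" using w(1) by (cases w) auto
  let ?v = "two_generator_word i 0 w"
  have "reduced ?v"
    using reduced_generator_power_append[OF reduced_two_generator_word[of l u i]] w(2) i by (simp add: lu)
  moreover have "two_generator_law ?v"
    unfolding two_generator_law_def
  proof (intro ballI)
    fix a b assume ab: "a \<in> carrier G" "b \<in> carrier G"
    then have "range (\<lambda>x. a [^] i x \<otimes> b \<otimes> inv (a [^] i x)) \<subseteq> carrier G" by auto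
    from law[OF this] show "word_eval G (generators a b) ?v = \<one>"
      using word_eval_two_generator_word[OF ab, of i 0 w] by simp
  qed
  ultimately show ?thesis by (intro exI[of _ ?v]) (simp add: lu)
qed

section \<open>From the uniform bound to vanishing scl\<close>

lemma commutator_products_power:
  fixes n m :: nat
  assumes nm: "\<And>a b. a \<in> carrier G \<Longrightarrow> b \<in> carrier G \<Longrightarrow>
      (a \<otimes> b \<otimes> inv a \<otimes> inv b) [^] n \<in> commutator_products m"
    and "g \<in> commutator_products k"
  shows "g [^] n \<in> commutator_products (k * (m + n div 2))"
  using assms(2)
proof (induction k arbitrary: g)
  case (Suc k)
  obtain c h where ch: "c \<in> derived_set G (carrier G)" "h \<in> commutator_products k" "g = c \<otimes> h"
    by (rule commutator_products_SucE[OF Suc.prems])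
  have c: "c \<in> carrier G" using ch(1) derived_set_closed by (rule subsetD[rotated])
  have h: "h \<in> carrier G" using ch(2) by (rule commutator_products_closed)
  obtain a b where "a \<in> carrier G" "b \<in> carrier G" "c = a \<otimes> b \<otimes> inv a \<otimes> inv b"
    using ch(1) by blast
  then have "c [^] n \<in> commutator_products m" using nm by simp
  then have "near (m + k * (m + n div 2)) (c [^] n \<otimes> h [^] n) \<one>"
    unfolding near_one using Suc.IH[OF ch(2)] by (rule commutator_products_add)
  then have "near (n div 2 + (m + k * (m + n div 2))) (g [^] n) \<one>"
    unfolding ch(3) by (rule near_trans[OF near_pow_mult[OF c h]])
  then show ?case by (simp add: near_one add_ac)
qed simp

text \<open>Each \<open>n\<close>-th power multiplies the commutator count by at most
  \<open>\<mu>\<close>, and \<open>2 * m < n\<close> makes \<open>\<mu> < n\<close>. Along the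
  exponents \<open>n^j\<close> the quotients decay like \<open>(\<mu>/n)^j\<close>; since the full
  limit exists, this subsequence determines it.\<close>

lemma scl_eq_0:
  fixes n m :: nat
  assumes n: "2 \<le> n" "2 * m < n"
    and nm: "\<And>a b. a \<in> carrier G \<Longrightarrow> b \<in> carrier G \<Longrightarrow>
      (a \<otimes> b \<otimes> inv a \<otimes> inv b) [^] n \<in> commutator_products m"
    and g: "g \<in> derived G (carrier G)"
  shows "scl G g = 0"
proof -
  define \<mu> where "\<mu> = m + n div 2"
  have \<mu>: "\<mu> < n" using n by (simp add: \<mu>_def)
  let ?k = "comm_length G g"
  have gk: "g \<in> commutator_products ?k" using g by (rule in_commutator_products_comm_length)
  have "g [^] (n ^ j) \<in> commutator_products (?k * \<mu> ^ j)" for j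
  proof (induction j)
    case 0
    then show ?case using gk commutator_products_closed[OF gk] by simp
  next
    case (Suc j)
    from commutator_products_power[OF nm this] show ?case
      using commutator_products_closed[OF gk] by (simp add: nat_pow_pow \<mu>_def mult_ac)
  qed
  then have "real (comm_length G (g [^] (n ^ j))) \<le> real (?k * \<mu> ^ j)" for j
    using comm_length_le_commutator_products of_nat_le_iff by blast
  then have le: "real (comm_length G (g [^] (n ^ j))) / real (n ^ j) \<le> real ?k * (real \<mu> / real n) ^ j" for j
    using divide_right_mono[of _ "real (?k * \<mu> ^ j)" "real (n ^ j)"] by (simp add: power_divide)
  have "(\<lambda>j. (real \<mu> / real n) ^ j) \<longlonglongrightarrow> 0"
    by (rule LIMSEQ_power_zero) (use \<mu> in simp)
  then have "(\<lambda>j. real ?k * (real \<mu> / real n) ^ j) \<longlonglongrightarrow> 0"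
    by (rule tendsto_mult_right_zero)
  then have "(\<lambda>j. real (comm_length G (g [^] (n ^ j))) / real (n ^ j)) \<longlonglongrightarrow> 0"
    by (rule tendsto_sandwich[OF _ _ tendsto_const, rotated 2]) (use le in auto)
  moreover have "strict_mono (\<lambda>j. n ^ j)"
    using n by (intro strict_monoI power_strict_increasing) auto
  from LIMSEQ_subseq_LIMSEQ[OF scl_limit[OF g] this]
  have "(\<lambda>j. real (comm_length G (g [^] (n ^ j))) / real (n ^ j)) \<longlonglongrightarrow> scl G g"
    by (simp add: o_def)
  ultimately show ?thesis by (rule LIMSEQ_unique[rotated])
qed

end

section \<open>From a law in an abstract free group to a reduced word\<close>

theorem mainTheorem1:
  fixes G :: "('g, 'm) monoid_scheme"
    and F :: "('f, 'n) monoid_scheme"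
    and w :: 'f and g :: 'g
  assumes "group G"
    and "is_free_group F"
    and "w \<in> carrier F"
    and "w \<noteq> \<one>\<^bsub>F\<^esub>"
    and "\<forall>\<rho>\<in>hom F G. \<rho> w = \<one>\<^bsub>G\<^esub>"
    and "g \<in> derived G (carrier G)"
  shows "scl G g = 0"
proof -
  interpret G: group G by fact
  obtain S where F: "group F" and S: "free_basis F S"
    using assms(2) by (auto simp: is_free_group_def)
  have SF: "S \<subseteq> carrier F" and "word_eval F (\<lambda>x. x) ` carrier (free_group S) = carrier F"
    using S by (auto simp: free_basis_def iso_def bij_betw_def)
  then obtain u where u: "reduced u" "fst ` set u \<subseteq> S" "w = word_eval F (\<lambda>x. x) u"
    using assms(3) by (force simp: free_group_def)
  have "u \<noteq> []" using assms(4) u(3) by (auto simp: word_eval_def)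
  \<comment> \<open>Any values on the basis extend to a homomorphism from \<open>F\<close> to
    \<open>G\<close>, so the law says that \<open>u\<close> vanishes under every assignment.\<close>
  have "word_eval G f u = \<one>\<^bsub>G\<^esub>" if f: "range f \<subseteq> carrier G" for f
  proof -
    have fS: "f ` S \<subseteq> carrier G" using f by auto
    obtain h where h: "h \<in> hom F G" "\<forall>x\<in>S. h x = f x"
      using free_basis_extension[OF F S assms(1) fS] by blast
    have "word_eval G f v = word_eval G (h \<circ> (\<lambda>x. x)) v" if "fst ` set v \<subseteq> S" for v
      using that h(2) by (induction v) (auto simp: word_eval_def)
    then have "word_eval G f u = h w"
      using group.hom_word_eval[OF F assms(1) h(1), of "\<lambda>x. x" S u] SF u by simp
    then show ?thesis using assms(5) h(1) by simp
  qed
  then obtain v where "v \<noteq> []" "reduced v" "G.two_generator_law v"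
    using G.two_generator_law_exists[OF \<open>u \<noteq> []\<close> u(1)] by blast
  then obtain v' where "v' \<noteq> []" "reduced (v' @ [hd v'])" "G.two_generator_law v'"
    using G.cyclically_reduced_law by blast
  from G.commutator_power_bound[OF this] obtain n m where "2 \<le> n" "2 * m < n"
    "\<forall>a\<in>carrier G. \<forall>b\<in>carrier G.
      (a \<otimes>\<^bsub>G\<^esub> b \<otimes>\<^bsub>G\<^esub> inv\<^bsub>G\<^esub> a \<otimes>\<^bsub>G\<^esub> inv\<^bsub>G\<^esub> b) [^]\<^bsub>G\<^esub> n \<in> G.commutator_products m"
    by blast
  then show ?thesis using G.scl_eq_0[OF _ _ _ assms(6)] by blast
qed

end
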